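(* Let $P\in\mathbb{R}^{q\times n}$, $A\in\mathbb{R}^{m\times n}$, $b\in\mathbb{R}^m$, and let $S=\{x\in\mathbb{R}^n\mid Ax\ge b\}\ne\emptyset$. Let $f\colon\mathbb{R}^q\to\mathbb{R}\cup\{-\infty,+\infty\}$ be quasi-concave and let $C=\{Y\mu\mid\mu\in\mathbb{R}^o_+\}\subseteq\mathbb{R}^q$ be a polyhedral convex pointed cone (possibly with empty interior) such that $f$ is $C$-monotone on $P[S]-C$ and $0^+P[S]\subseteq C$. Define $$R=\left\{\lambda+\begin{pmatrix}Y\mu\\-e^{\top}Y\mu\end{pmatrix}\,\middle|\,\lambda\in\mathbb{R}^{q+1}_+,\ \mu\in\mathbb{R}^o_+\right\}\subseteq\mathbb{R}^{q+1},\qquad \bar P=\begin{pmatrix}P\\-e^{\top}P\end{pmatrix},$$ and $\bar f\colon\mathbb{R}^{q+1}\to\mathbb{R}\cup\{-\infty,+\infty\}$ by $\bar f\begin{pmatrix}y\\\eta\end{pmatrix}=f(y)$ if $e^{\top}y+\eta\ge 0$ and $\bar f\begin{pmatrix}y\\\eta\end{pmatrix}=-\infty$ otherwise. Then the primal algorithm and the dual algorithm described in the context, applied to the reformulated problem $$\min\bar f(\bar Px)\quad\text{s.t.}\quad Ax\ge b$$ with ordering cone $R$ (that is, run with $p=q+1$, $F=\bar f$, $M=\bar P$, $K=R$), are correct and finite: for any admissible choices made during the execution, all steps can be carried out, the algorithm terminates after finitely many iterations, and the returned point $x$ is an optimal solution of $\min f(Px)$ s.t. $Ax\ge b$.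
   Context: Notation: $e$ is the all-ones vector of appropriate dimension. $P[S]=\{Px\mid x\in S\}$; sums and differences of sets are Minkowski sums and differences; $0^+D$ is the recession cone of a nonempty polyhedron $D$. A cone $C$ is pointed if $C\cap(-C)=\{0\}$. $f$ is quasi-concave if all sets $\{y\mid f(y)\ge r\}$, $r\in\mathbb{R}$, are convex. $x\le_C y$ means $y-x\in C$; $f$ is $C$-monotone on $D$ if $x,y\in D$, $x\le_C y$ imply $f(x)\le f(y)$. Both algorithms are for a problem $\min F(Mx)$ s.t. $Ax\ge b$ with $M\in\mathbb{R}^{p\times n}$, $F\colon\mathbb{R}^p\to\mathbb{R}\cup\{\pm\infty\}$, a polyhedral pointed cone with nonempty interior $K=\{V\lambda\mid\lambda\ge 0\}=\{y\in\mathbb{R}^p\mid Z^{\top}y\ge 0\}$, a point $c\in\operatorname{int}K$ (with $c_p=1$ for the dual algorithm), and a polyhedron $\mathcal{O}\subseteq\mathbb{R}^p$ with $\mathcal{O}\supseteq M[S]+K$ and $0^+\mathcal{O}=K$. Primal algorithm. For $t\in\mathbb{R}^p$ let $(\mathrm{P}_2(t))$ be the linear program $\min z$ over $(x,z)\in\mathbb{R}^n\times\mathbb{R}$ s.t. $Ax\ge b$, $Z^{\top}Mx\le Z^{\top}t+zZ^{\top}c$, and let $(\mathrm{D}_2(t))$ be $\max b^{\top}u-t^{\top}w$ over $(u,w)$ s.t. $A^{\top}u=M^{\top}w$, $c^{\top}w=1$, $V^{\top}w\ge 0$, $u\ge 0$. Compute the vertex set $\mathcal{O}_{\rm poi}$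 of $\mathcal{O}$ and loop: choose any $t\in\mathcal{O}_{\rm poi}$ minimizing $F$ over $\mathcal{O}_{\rm poi}$; compute any optimal solutions $(x,z)$ of $(\mathrm{P}_2(t))$ and $(u,w)$ of $(\mathrm{D}_2(t))$; if $z>0$, replace $\mathcal{O}$ by $\mathcal{O}\cap\{y\mid w^{\top}y\ge b^{\top}u\}$, recompute its vertex set $\mathcal{O}_{\rm poi}$ and continue; otherwise stop and return $x$. Dual algorithm. Put $\varphi(y,y^* )=\sum_{i=1}^{p-1}y_iy_i^*+y_p\bigl(1-\sum_{i=1}^{p-1}c_iy_i^*\bigr)-y_p^*$ and $\omega(y^* )=\bigl(y_1^*,\dots,y_{p-1}^*,1-\sum_{i=1}^{p-1}c_iy_i^*\bigr)^{\top}$. For $w\in\mathbb{R}^p$ let $(\mathrm{P}_1(w))$ be $\min w^{\top}Mx$ s.t. $Ax\ge b$. Initialize $\mathcal{O}^*:=\{y^*\in\mathbb{R}^p\mid y^{\top}\omega(y^* )\ge 0\text{ for every column }y\text{ of }V\}$, $T^*:=\emptyset$, $w:=$ sum of the columns of $Z$, $t^*:=(c^{\top}w)^{-1}w$, then reset $t^*_p:=+\infty$. Loop: (1) $w:=\omega(t^* )$; let $x$ be any optimal solution of $(\mathrm{P}_1(w))$. (2) If $t^*_p-w^{\top}Mx>0$, replace $\mathcal{O}^*$ by $\mathcal{O}^*\cap\{y^*\mid\varphi(Mx,y^* )\ge 0\}$ and recompute its vertex set $\mathcal{O}^*_{\rm poi}$; otherwise replace $T^*$ by $T^*\cup\{t^*\}$.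 (3) Replace $\mathcal{O}$ by $\mathcal{O}\cap\{y\mid w^{\top}y\ge w^{\top}Mx\}$, recompute its vertex set $\mathcal{O}_{\rm poi}$, and choose any $t\in\mathcal{O}_{\rm poi}$ minimizing $F$ over $\mathcal{O}_{\rm poi}$. (4) If $\min\{\varphi(t,y^* )\mid y^*\in\mathcal{O}^*_{\rm poi}\}<0$, choose any $t^*$ minimizing $\varphi(t,\cdot)$ over $\mathcal{O}^*_{\rm poi}\setminus T^*$ and continue; otherwise determine some $x\in S$ with $t=Mx$, stop, and return $x$. *)

theory Defs
  imports "HOL-Analysis.Analysis"
begin

section \<open>Polyhedral and order-theoretic notions\<close>

text \<open>Inequalities between vectors are componentwise, and \<open>1 :: real ^ 'q\<close> is the all-ones vector.\<close>

definition feasible :: "real ^ 'n ^ 'm \<Rightarrow> real ^ 'm \<Rightarrow> (real ^ 'n) set" where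
  "feasible A b = {x. b \<le> A *v x}"

definition generated_cone :: "real ^ 'k ^ 'p \<Rightarrow> (real ^ 'p) set" where
  "generated_cone V = {V *v \<mu> | \<mu>. 0 \<le> \<mu>}"

definition pointed :: "'a::real_vector set \<Rightarrow> bool" where
  "pointed C \<longleftrightarrow> C \<inter> uminus ` C = {0}"

text \<open>Meant for nonempty polyhedra (closed convex sets).\<close>

definition recession_cone :: "'a::real_vector set \<Rightarrow> 'a set" where
  "recession_cone D = {d. \<forall>y\<in>D. \<forall>s\<ge>0. y + s *\<^sub>R d \<in> D}"

definition vertices :: "'a::real_vector set \<Rightarrow> 'a set" where
  "vertices D = {v. v extreme_point_of D}"

definition quasi_concave :: "('a::real_vector \<Rightarrow> ereal) \<Rightarrow> bool" where
  "quasi_concave f \<longleftrightarrow> (\<forall>r::real. convex {y. f y \<ge> ereal r})"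

definition cone_monotone_on :: "'a::real_vector set \<Rightarrow> 'a set \<Rightarrow> ('a \<Rightarrow> ereal) \<Rightarrow> bool" where
  "cone_monotone_on C D f \<longleftrightarrow> (\<forall>x\<in>D. \<forall>y\<in>D. y - x \<in> C \<longrightarrow> f x \<le> f y)"


section \<open>Nondeterministic algorithms\<close>

text \<open>
  An algorithm is a small-step relation on program states; every choice is a separate step.
  It is correct and finite if, from the initial state, (i) no execution gets stuck before
  returning a value, (ii) no execution is infinite, and (iii) every returned value is as specified.
\<close>

definition correct_and_finite ::
    "('s \<Rightarrow> 's \<Rightarrow> bool) \<Rightarrow> 's \<Rightarrow> ('x \<Rightarrow> 's) \<Rightarrow> ('x \<Rightarrow> bool) \<Rightarrow> bool" where
  "correct_and_finite step init ret spec \<longleftrightarrow>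
     (\<forall>s. step\<^sup>*\<^sup>* init s \<longrightarrow> (\<exists>x. s = ret x) \<or> (\<exists>s'. step s s')) \<and>
     (\<nexists>\<sigma>::nat \<Rightarrow> 's. \<sigma> 0 = init \<and> (\<forall>i. step (\<sigma> i) (\<sigma> (Suc i)))) \<and>
     (\<forall>x. step\<^sup>*\<^sup>* init (ret x) \<longrightarrow> spec x)"


section \<open>The primal algorithm\<close>

definition P2_feasible ::
    "real ^ 'n ^ 'm \<Rightarrow> real ^ 'm \<Rightarrow> real ^ 'n ^ 'p \<Rightarrow> real ^ 'z ^ 'p \<Rightarrow> real ^ 'p \<Rightarrow> real ^ 'p
      \<Rightarrow> (real ^ 'n) \<times> real \<Rightarrow> bool" where
  "P2_feasible A b M Z c t = (\<lambda>(x, z).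
     b \<le> A *v x \<and>
     transpose Z *v (M *v x) \<le> transpose Z *v t + z *\<^sub>R (transpose Z *v c))"

definition P2_optimal ::
    "real ^ 'n ^ 'm \<Rightarrow> real ^ 'm \<Rightarrow> real ^ 'n ^ 'p \<Rightarrow> real ^ 'z ^ 'p \<Rightarrow> real ^ 'p \<Rightarrow> real ^ 'p
      \<Rightarrow> (real ^ 'n) \<times> real \<Rightarrow> bool" where
  "P2_optimal A b M Z c t = is_arg_min (\<lambda>(x, z). z) (P2_feasible A b M Z c t)"

definition D2_feasible ::
    "real ^ 'n ^ 'm \<Rightarrow> real ^ 'n ^ 'p \<Rightarrow> real ^ 'v ^ 'p \<Rightarrow> real ^ 'p
      \<Rightarrow> (real ^ 'm) \<times> (real ^ 'p) \<Rightarrow> bool" where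
  "D2_feasible A M V c = (\<lambda>(u, w).
     transpose A *v u = transpose M *v w \<and> c \<bullet> w = 1 \<and> 0 \<le> transpose V *v w \<and> 0 \<le> u)"

definition D2_optimal ::
    "real ^ 'n ^ 'm \<Rightarrow> real ^ 'm \<Rightarrow> real ^ 'n ^ 'p \<Rightarrow> real ^ 'v ^ 'p \<Rightarrow> real ^ 'p \<Rightarrow> real ^ 'p
      \<Rightarrow> (real ^ 'm) \<times> (real ^ 'p) \<Rightarrow> bool" where
  "D2_optimal A b M V c t = is_arg_max (\<lambda>(u, w). b \<bullet> u - t \<bullet> w) (D2_feasible A M V c)"

text \<open>
  \<open>Q\<close> is the current outer approximation and \<open>Qpoi\<close> its computed vertex set. Computing a
  vertex set is possible only if it is finite.
\<close>

datatype ('n::finite, 'm::finite, 'p::finite) primal_state =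
    PEnumerate "(real ^ 'p) set"
  | PChoose "(real ^ 'p) set" "(real ^ 'p) set"
  | PSolveP "(real ^ 'p) set" "real ^ 'p"
  | PSolveD "(real ^ 'p) set" "real ^ 'p" "real ^ 'n" real
  | PTest "(real ^ 'p) set" "real ^ 'n" real "real ^ 'm" "real ^ 'p"
  | PReturn "real ^ 'n"

inductive primal_step ::
    "real ^ 'n ^ 'm \<Rightarrow> real ^ 'm \<Rightarrow> real ^ 'n ^ 'p \<Rightarrow> (real ^ 'p \<Rightarrow> ereal)
      \<Rightarrow> real ^ 'v ^ 'p \<Rightarrow> real ^ 'z ^ 'p \<Rightarrow> real ^ 'p
      \<Rightarrow> ('n, 'm, 'p) primal_state \<Rightarrow> ('n, 'm, 'p) primal_state \<Rightarrow> bool"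
  for A b M F V Z c where
  enumerate: "finite (vertices Q) \<Longrightarrow>
    primal_step A b M F V Z c (PEnumerate Q) (PChoose Q (vertices Q))"
| choose: "is_arg_min F (\<lambda>y. y \<in> Qpoi) t \<Longrightarrow>
    primal_step A b M F V Z c (PChoose Q Qpoi) (PSolveP Q t)"
| solve_P2: "P2_optimal A b M Z c t (x, z) \<Longrightarrow>
    primal_step A b M F V Z c (PSolveP Q t) (PSolveD Q t x z)"
| solve_D2: "D2_optimal A b M V c t (u, w) \<Longrightarrow>
    primal_step A b M F V Z c (PSolveD Q t x z) (PTest Q x z u w)"
| cut: "z > 0 \<Longrightarrow>
    primal_step A b M F V Z c (PTest Q x z u w) (PEnumerate (Q \<inter> {y. w \<bullet> y \<ge> b \<bullet> u}))"
| stop: "\<not> z > 0 \<Longrightarrow>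
    primal_step A b M F V Z c (PTest Q x z u w) (PReturn x)"


section \<open>The dual algorithm\<close>

text \<open>The index \<open>l\<close> plays the role of the last coordinate \<open>p\<close>.\<close>

definition phi :: "'p::finite \<Rightarrow> real ^ 'p \<Rightarrow> real ^ 'p \<Rightarrow> real ^ 'p \<Rightarrow> real" where
  "phi l c y ys = (\<Sum>i\<in>UNIV - {l}. y $ i * ys $ i)
     + y $ l * (1 - (\<Sum>i\<in>UNIV - {l}. c $ i * ys $ i)) - ys $ l"

definition omega :: "'p::finite \<Rightarrow> real ^ 'p \<Rightarrow> real ^ 'p \<Rightarrow> real ^ 'p" where
  "omega l c ys = (\<chi> i. if i = l then 1 - (\<Sum>j\<in>UNIV - {l}. c $ j * ys $ j) else ys $ i)"

definition P1_optimal ::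
    "real ^ 'n ^ 'm \<Rightarrow> real ^ 'm \<Rightarrow> real ^ 'n ^ 'p \<Rightarrow> real ^ 'p \<Rightarrow> real ^ 'n \<Rightarrow> bool" where
  "P1_optimal A b M w = is_arg_min (\<lambda>x. w \<bullet> (M *v x)) (\<lambda>x. b \<le> A *v x)"

text \<open>
  \<open>Q\<close> and \<open>Qs\<close> are the primal and dual outer approximations (with computed vertex sets \<open>Qpoi\<close>
  and \<open>Qspoi\<close>), \<open>T\<close> is \<open>T\<^sup>*\<close>. The current \<open>t\<^sup>*\<close> may have last
  coordinate \<open>\<infinity>\<close>: that coordinate is stored separately as \<open>tp\<close>, and entry \<open>l\<close> of
  \<open>ts\<close> is relevant only if \<open>tp\<close> is finite, in which case \<open>tp = ts $ l\<close>. (Note that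
  \<open>omega l c ts\<close> does not depend on \<open>ts $ l\<close>, and that the branch adding \<open>t\<^sup>*\<close> to
  \<open>T\<close> is never taken with \<open>tp = \<infinity>\<close>.) \<open>Qspoi\<close> is \<open>None\<close> until the dual vertex
  set is computed for the first time.
\<close>

datatype ('n::finite, 'p::finite) dual_state =
    DSolve "(real ^ 'p) set" "(real ^ 'p) set" "(real ^ 'p) set option" "(real ^ 'p) set"
      "real ^ 'p" ereal
  | DUpdate "(real ^ 'p) set" "(real ^ 'p) set" "(real ^ 'p) set option" "(real ^ 'p) set"
      "real ^ 'p" ereal "real ^ 'n"
  | DEnumDual "(real ^ 'p) set" "(real ^ 'p) set" "(real ^ 'p) set" "real ^ 'p" "real ^ 'n"
  | DCutPrimal "(real ^ 'p) set" "(real ^ 'p) set" "(real ^ 'p) set option" "(real ^ 'p) set"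
      "real ^ 'p" "real ^ 'n"
  | DEnumPrimal "(real ^ 'p) set" "(real ^ 'p) set" "(real ^ 'p) set option" "(real ^ 'p) set"
  | DChoose "(real ^ 'p) set" "(real ^ 'p) set" "(real ^ 'p) set" "(real ^ 'p) set option"
      "(real ^ 'p) set"
  | DTest "(real ^ 'p) set" "(real ^ 'p) set" "(real ^ 'p) set option" "(real ^ 'p) set" "real ^ 'p"
  | DSelect "(real ^ 'p) set" "(real ^ 'p) set" "(real ^ 'p) set" "(real ^ 'p) set" "real ^ 'p"
  | DRecover "real ^ 'p"
  | DReturn "real ^ 'n"

inductive dual_step ::
    "'p::finite \<Rightarrow> real ^ 'n ^ 'm \<Rightarrow> real ^ 'm \<Rightarrow> real ^ 'n ^ 'p
      \<Rightarrow> (real ^ 'p \<Rightarrow> ereal) \<Rightarrow> real ^ 'p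
      \<Rightarrow> ('n, 'p) dual_state \<Rightarrow> ('n, 'p) dual_state \<Rightarrow> bool"
  for l A b M F c where
  solve_P1: "P1_optimal A b M (omega l c ts) x \<Longrightarrow>
    dual_step l A b M F c (DSolve Q Qs Qspoi T ts tp) (DUpdate Q Qs Qspoi T ts tp x)"
| cut_dual: "tp - ereal (omega l c ts \<bullet> (M *v x)) > 0 \<Longrightarrow>
    dual_step l A b M F c (DUpdate Q Qs Qspoi T ts tp x)
      (DEnumDual Q (Qs \<inter> {ys. phi l c (M *v x) ys \<ge> 0}) T ts x)"
| enumerate_dual: "finite (vertices Qs) \<Longrightarrow>
    dual_step l A b M F c (DEnumDual Q Qs T ts x) (DCutPrimal Q Qs (Some (vertices Qs)) T ts x)"
| keep_dual: "\<not> tp - ereal (omega l c ts \<bullet> (M *v x)) > 0 \<Longrightarrow>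
    dual_step l A b M F c (DUpdate Q Qs Qspoi T ts tp x) (DCutPrimal Q Qs Qspoi (T \<union> {ts}) ts x)"
| cut_primal: "dual_step l A b M F c (DCutPrimal Q Qs Qspoi T ts x)
    (DEnumPrimal (Q \<inter> {y. omega l c ts \<bullet> y \<ge> omega l c ts \<bullet> (M *v x)}) Qs Qspoi T)"
| enumerate_primal: "finite (vertices Q) \<Longrightarrow>
    dual_step l A b M F c (DEnumPrimal Q Qs Qspoi T) (DChoose Q (vertices Q) Qs Qspoi T)"
| choose: "is_arg_min F (\<lambda>y. y \<in> Qpoi) t \<Longrightarrow>
    dual_step l A b M F c (DChoose Q Qpoi Qs Qspoi T) (DTest Q Qs Qspoi T t)"
| test_continue: "is_arg_min (phi l c t) (\<lambda>ys. ys \<in> Qspoi) ys \<Longrightarrow> phi l c t ys < 0 \<Longrightarrow>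
    dual_step l A b M F c (DTest Q Qs (Some Qspoi) T t) (DSelect Q Qs Qspoi T t)"
| test_stop: "is_arg_min (phi l c t) (\<lambda>ys. ys \<in> Qspoi) ys \<Longrightarrow> \<not> phi l c t ys < 0 \<Longrightarrow>
    dual_step l A b M F c (DTest Q Qs (Some Qspoi) T t) (DRecover t)"
| select: "is_arg_min (phi l c t) (\<lambda>ys. ys \<in> Qspoi - T) ts \<Longrightarrow>
    dual_step l A b M F c (DSelect Q Qs Qspoi T t) (DSolve Q Qs (Some Qspoi) T ts (ereal (ts $ l)))"
| recover: "x \<in> feasible A b \<Longrightarrow> t = M *v x \<Longrightarrow>
    dual_step l A b M F c (DRecover t) (DReturn x)"

definition dual_init ::
    "'p::finite \<Rightarrow> real ^ 'v ^ 'p \<Rightarrow> real ^ 'z ^ 'p \<Rightarrow> real ^ 'p \<Rightarrow> (real ^ 'p) set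
      \<Rightarrow> ('n::finite, 'p) dual_state" where
  "dual_init l V Z c Q =
     (let w = (\<Sum>j\<in>UNIV. column j Z)
      in DSolve Q {ys. \<forall>j. column j V \<bullet> omega l c ys \<ge> 0} None {}
           (inverse (c \<bullet> w) *\<^sub>R w) \<infinity>)"


section \<open>The reformulated problem\<close>

text \<open>
  \<open>\<real>\<^sup>q\<^sup>+\<^sup>1\<close> is indexed by \<open>'q option\<close>; the coordinates \<open>Some i\<close> are the first
  \<open>q\<close> ones and \<open>None\<close> is the last one.
\<close>

definition stack :: "real ^ 'q \<Rightarrow> real \<Rightarrow> real ^ 'q option" where
  "stack y \<eta> = (\<chi> j. case j of Some i \<Rightarrow> y $ i | None \<Rightarrow> \<eta>)"

definition R_cone :: "real ^ 'o ^ 'q \<Rightarrow> (real ^ 'q option) set" where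
  "R_cone Y = {a + stack (Y *v \<mu>) (- (1 \<bullet> (Y *v \<mu>))) | a \<mu>. 0 \<le> a \<and> 0 \<le> \<mu>}"

definition P_bar :: "real ^ 'n ^ 'q \<Rightarrow> real ^ 'n ^ 'q option" where
  "P_bar P = (\<chi> j. case j of Some i \<Rightarrow> P $ i | None \<Rightarrow> - (1 v* P))"

definition f_bar :: "(real ^ 'q \<Rightarrow> ereal) \<Rightarrow> real ^ 'q option \<Rightarrow> ereal" where
  "f_bar f v = (let y = (\<chi> i. v $ Some i); \<eta> = v $ None
                in if 1 \<bullet> y + \<eta> \<ge> 0 then f y else - \<infinity>)"

end

theory Submission
  imports Defs
begin

text \<open>
  The function \<open>f_bar f\<close> is \<open>-\<infinity>\<close> off the half-space \<open>e\<^sup>T y + \<eta> \<ge> 0\<close>, which touches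
  \<open>P_bar P [S] - R\<close> only along the lifted copy of \<open>P [S] - C\<close>. So \<open>f_bar f\<close> is quasi-concave and
  \<open>R\<close>-monotone there, and it suffices to treat an ordering cone with nonempty interior.

  An outer approximation with recession cone \<open>K\<close> is the sum of \<open>K\<close> and the convex hull of its
  vertices. Hence the best vertex bounds the optimal value from below, and the method is done once that
  vertex lies in \<open>M[S] + K\<close>, where it must be an image point \<open>M x\<close>. Linear programming duality
  provides the cuts. Finiteness does not depend on which optimal solutions are returned: each cut
  deactivates a face (a pair of faces of \<open>S\<close> and \<open>K\<close> in the primal, a face of \<open>S\<close> in the dual
  algorithm), and there are finitely many.
\<close>

section \<open>Linear inequalities and polyhedra\<close>

text \<open>The extra row puts all image points on the hyperplane \<open>1 \<bullet> v = 0\<close>,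
  and the orthant summand gives the ordering cone an interior while adding nothing inside that
  hyperplane. An interior point \<open>c\<close> makes every nonzero dual vector positive at
  \<open>c\<close>, so weights can be normalised by \<open>w \<bullet> c = 1\<close>. Returned
  solutions need not be extreme, so there may be infinitely many possible cuts; this is why faces
  are counted. In the dual algorithm \<open>ys\<close> encodes the weight
  \<open>omega l c ys\<close> together with a guessed lower bound \<open>ys $ l\<close> for that
  weight on the image of the feasible set, and \<open>phi l c y ys\<close> is the slack of
  \<open>y\<close> in the resulting inequality. The set \<open>T\<close> collects confirmed guesses;
  their inequalities hold on the primal set, so a violated dual vertex always lies outside
  \<open>T\<close>.\<close>

lemma farkas_cone:
  fixes a :: "'i \<Rightarrow> 'a::euclidean_space"
  assumes "finite I" and "\<nexists>y. (\<forall>i\<in>I. 0 \<le> y i) \<and> (\<Sum>i\<in>I. y i *\<^sub>R a i) = d"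
  obtains x where "\<And>i. i \<in> I \<Longrightarrow> 0 \<le> x \<bullet> a i" and "x \<bullet> d < 0"
proof -
  let ?W = "{\<Sum>i\<in>I. y i *\<^sub>R a i | y. \<forall>i\<in>I. 0 \<le> y i}"
  let ?H = "convex_cone hull (a ` I)"
  have "?H \<subseteq> ?W"
  proof (rule hull_minimal)
    show "a ` I \<subseteq> ?W"
    proof clarify
      fix j assume "j \<in> I"
      then have "(\<Sum>i\<in>I. (if i = j then 1 else 0) *\<^sub>R a i) = a j"
        using \<open>finite I\<close> by (simp add: if_distrib[of "\<lambda>s. s *\<^sub>R _"] cong: if_cong)
      then show "\<exists>y. a j = (\<Sum>i\<in>I. y i *\<^sub>R a i) \<and> (\<forall>i\<in>I. 0 \<le> y i)"
        by (intro exI[of _ "\<lambda>i. if i = j then 1 else 0"]) simp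
    qed
    show "convex_cone ?W"
      unfolding convex_cone_iff
    proof (intro conjI ballI allI impI)
      show "0 \<in> ?W"
        by (auto intro!: exI[of _ "\<lambda>_. 0"])
      show "x + y \<in> ?W" if "x \<in> ?W" "y \<in> ?W" for x y
      proof -
        from that obtain u v where "\<forall>i\<in>I. 0 \<le> u i" "\<forall>i\<in>I. 0 \<le> v i"
          "x = (\<Sum>i\<in>I. u i *\<^sub>R a i)" "y = (\<Sum>i\<in>I. v i *\<^sub>R a i)"
          by blast
        then show ?thesis
          by (intro CollectI exI[of _ "\<lambda>i. u i + v i"]) (simp add: scaleR_add_left sum.distrib)
      qed
      show "s *\<^sub>R x \<in> ?W" if "x \<in> ?W" "0 \<le> s" for x s
      proof -
        from that(1) obtain u where "\<forall>i\<in>I. 0 \<le> u i" "x = (\<Sum>i\<in>I. u i *\<^sub>R a i)"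
          by blast
        with \<open>0 \<le> s\<close> show ?thesis
          by (intro CollectI exI[of _ "\<lambda>i. s * u i"]) (simp add: scaleR_sum_right)
      qed
    qed
  qed
  then have "d \<notin> ?H"
    using assms(2) by blast
  \<comment> \<open>A finitely generated cone is closed, so a point outside it can be separated
    strictly.\<close>
  then obtain x \<beta> where x: "x \<bullet> d < \<beta>" "\<And>h. h \<in> ?H \<Longrightarrow> \<beta> < x \<bullet> h"
    using separating_hyperplane_closed_point[OF convex_convex_cone_hull closed_convex_cone_hull,
        OF finite_imageI[OF \<open>finite I\<close>]] by blast
  have "\<beta> < 0"
    using x(2)[OF convex_cone_hull_contains_0] by simp
  show thesis
  proof
    show "x \<bullet> d < 0"
      using x(1) \<open>\<beta> < 0\<close> by simp
    show "0 \<le> x \<bullet> a i" if "i \<in> I" for i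
    proof (rule ccontr)
      assume neg: "\<not> 0 \<le> x \<bullet> a i"
      \<comment> \<open>This multiple of the generator has inner product exactly
        \<open>\<beta>\<close> with \<open>x\<close>, against the strict separation.\<close>
      then have "(\<beta> / (x \<bullet> a i)) *\<^sub>R a i \<in> ?H"
        using \<open>\<beta> < 0\<close> that by (intro convex_cone_hull_mul hull_inc) (auto intro: divide_nonpos_neg)
      from x(2)[OF this] show False
        using neg by simp
    qed
  qed
qed

text \<open>Homogenisation: each inequality becomes a generator \<open>(a i, \<beta> i)\<close>, and
  the generator \<open>(0, -1)\<close> absorbs the slack in the last coordinate. If
  \<open>(d, \<gamma>)\<close> is not generated, the separating vector \<open>(x, s)\<close> has
  \<open>s \<le> 0\<close>: for \<open>s < 0\<close> it rescales to a feasible point with value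
  below \<open>\<gamma>\<close>, for \<open>s = 0\<close> it is a direction of unbounded
  descent.\<close>

lemma affine_farkas:
  fixes a :: "'i \<Rightarrow> 'a::euclidean_space" and \<beta> :: "'i \<Rightarrow> real"
  assumes "finite I" and x0: "\<forall>i\<in>I. \<beta> i \<le> x0 \<bullet> a i"
    and bound: "\<And>x. \<forall>i\<in>I. \<beta> i \<le> x \<bullet> a i \<Longrightarrow> \<gamma> \<le> x \<bullet> d"
  obtains y where "\<And>i. i \<in> I \<Longrightarrow> 0 \<le> y i" and "(\<Sum>i\<in>I. y i *\<^sub>R a i) = d"
    and "\<gamma> \<le> (\<Sum>i\<in>I. y i * \<beta> i)"
proof -
  let ?J = "insert None (Some ` I)"
  have fin: "finite ?J"
    using \<open>finite I\<close> by simp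
  define g :: "'i option \<Rightarrow> 'a \<times> real"
    where "g = (\<lambda>j. case j of None \<Rightarrow> (0, -1) | Some i \<Rightarrow> (a i, \<beta> i))"
  have "\<exists>y. (\<forall>j\<in>?J. 0 \<le> y j) \<and> (\<Sum>j\<in>?J. y j *\<^sub>R g j) = (d, \<gamma>)"
  proof (rule ccontr)
    assume none: "\<not> ?thesis"
    obtain z where z: "\<And>j. j \<in> ?J \<Longrightarrow> 0 \<le> z \<bullet> g j" "z \<bullet> (d, \<gamma>) < 0"
      using farkas_cone[OF fin none] by blast
    obtain x s where zxs: "z = (x, s)" by fastforce
    have s: "s \<le> 0" and xs: "\<And>i. i \<in> I \<Longrightarrow> 0 \<le> x \<bullet> a i + s * \<beta> i" and neg: "x \<bullet> d + s * \<gamma> < 0"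
      using z(1)[of None] z(1)[of "Some _"] z(2) by (auto simp: g_def zxs)
    show False
    proof (cases "s = 0")
      case True
      \<comment> \<open>Large enough to bring the objective at \<open>x0 + m *\<^sub>R x\<close>
        down to \<open>\<gamma> - 1\<close> or less.\<close>
      define m where "m = max 0 ((x0 \<bullet> d - \<gamma> + 1) / (- (x \<bullet> d)))"
      have "0 \<le> m" and m: "(x0 \<bullet> d - \<gamma> + 1) / (- (x \<bullet> d)) \<le> m"
        by (simp_all add: m_def)
      have "\<forall>i\<in>I. \<beta> i \<le> (x0 + m *\<^sub>R x) \<bullet> a i"
        using x0 xs True \<open>0 \<le> m\<close> by (auto simp: inner_add_left intro: add_increasing2)
      from bound[OF this] m neg True show False
        by (simp add: inner_add_left field_simps)
    next
      case False
      then have "s < 0" using s by simp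
      have "\<forall>i\<in>I. \<beta> i \<le> ((- 1 / s) *\<^sub>R x) \<bullet> a i"
        using \<open>s < 0\<close> by (auto simp: field_simps dest!: xs)
      from bound[OF this] neg \<open>s < 0\<close> show False
        by (simp add: field_simps)
    qed
  qed
  then obtain y where y: "\<And>j. j \<in> ?J \<Longrightarrow> 0 \<le> y j" "(\<Sum>j\<in>?J. y j *\<^sub>R g j) = (d, \<gamma>)" by blast
  have "(\<Sum>j\<in>?J. y j *\<^sub>R g j) = y None *\<^sub>R (0, -1) + (\<Sum>i\<in>I. y (Some i) *\<^sub>R (a i, \<beta> i))"
    using \<open>finite I\<close> by (subst sum.insert) (auto simp: g_def sum.reindex)
  with y(2) have "(\<Sum>i\<in>I. y (Some i) *\<^sub>R a i) = d" "(\<Sum>i\<in>I. y (Some i) * \<beta> i) - y None = \<gamma>"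
    by (auto simp: prod_eq_iff fst_sum snd_sum)
  then show thesis
    using y(1)[of "Some _"] y(1)[of None] by (intro that[of "\<lambda>i. y (Some i)"]) auto
qed

text \<open>If the infimum \<open>\<mu>\<close> were missed, the constraints would be inconsistent
  with \<open>x \<bullet> d \<le> \<mu>\<close>. The certificate of inconsistency gives this extra
  inequality a positive weight \<open>y None\<close>, which raises the lower bound to
  \<open>\<mu> + 1 / y None\<close>.\<close>

lemma LP_attains:
  fixes a :: "'i \<Rightarrow> 'a::euclidean_space" and \<beta> :: "'i \<Rightarrow> real"
  assumes "finite I" and x0: "\<forall>i\<in>I. \<beta> i \<le> x0 \<bullet> a i"
    and bound: "\<And>x. \<forall>i\<in>I. \<beta> i \<le> x \<bullet> a i \<Longrightarrow> \<gamma> \<le> x \<bullet> d"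
  obtains x where "\<forall>i\<in>I. \<beta> i \<le> x \<bullet> a i"
    and "\<And>x'. \<forall>i\<in>I. \<beta> i \<le> x' \<bullet> a i \<Longrightarrow> x \<bullet> d \<le> x' \<bullet> d"
proof -
  define X where "X = {x. \<forall>i\<in>I. \<beta> i \<le> x \<bullet> a i}"
  define \<mu> where "\<mu> = (INF x\<in>X. x \<bullet> d)"
  have bdd: "bdd_below ((\<lambda>x. x \<bullet> d) ` X)"
    using bound by (auto simp: X_def bdd_below_def)
  have X: "X \<noteq> {}"
    using x0 by (auto simp: X_def)
  have lower: "\<mu> \<le> x \<bullet> d" if "x \<in> X" for x
    unfolding \<mu>_def using bdd that by (rule cINF_lower)
  have "\<exists>x\<in>X. x \<bullet> d \<le> \<mu>"
  proof (rule ccontr)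
    assume above: "\<not> ?thesis"
    let ?J = "insert None (Some ` I)"
    have fin: "finite ?J"
      using \<open>finite I\<close> by simp
    define g :: "'i option \<Rightarrow> 'a \<times> real"
      where "g = (\<lambda>j. case j of None \<Rightarrow> (- d, - \<mu>) | Some i \<Rightarrow> (a i, \<beta> i))"
    have "\<exists>y. (\<forall>j\<in>?J. 0 \<le> y j) \<and> (\<Sum>j\<in>?J. y j *\<^sub>R g j) = (0, 1)"
    proof (rule ccontr)
      assume none: "\<not> ?thesis"
      obtain z where z: "\<And>j. j \<in> ?J \<Longrightarrow> 0 \<le> z \<bullet> g j" "z \<bullet> (0, 1) < 0"
        using farkas_cone[OF fin none] by blast
      obtain x s where zxs: "z = (x, s)" by fastforce
      have s: "s < 0" and xs: "\<And>i. i \<in> I \<Longrightarrow> 0 \<le> x \<bullet> a i + s * \<beta> i" and neg: "x \<bullet> d + s * \<mu> \<le> 0"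
        using z(1)[of None] z(1)[of "Some _"] z(2) by (auto simp: g_def zxs)
      have "(- 1 / s) *\<^sub>R x \<in> X"
        using s by (auto simp: X_def field_simps dest!: xs)
      with above neg s show False
        by (auto simp: field_simps)
    qed
    then obtain y where y: "\<And>j. j \<in> ?J \<Longrightarrow> 0 \<le> y j" "(\<Sum>j\<in>?J. y j *\<^sub>R g j) = (0, 1)" by blast
    have "(\<Sum>j\<in>?J. y j *\<^sub>R g j) = y None *\<^sub>R (- d, - \<mu>) + (\<Sum>i\<in>I. y (Some i) *\<^sub>R (a i, \<beta> i))"
      using \<open>finite I\<close> by (subst sum.insert) (auto simp: g_def sum.reindex)
    with y(2) have eq: "(\<Sum>i\<in>I. y (Some i) *\<^sub>R a i) = y None *\<^sub>R d"
      "(\<Sum>i\<in>I. y (Some i) * \<beta> i) = 1 + y None * \<mu>"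
      by (auto simp: prod_eq_iff fst_sum snd_sum algebra_simps)
    have weak: "1 + y None * \<mu> \<le> y None * (x \<bullet> d)" if "x \<in> X" for x
    proof -
      have "1 + y None * \<mu> \<le> (\<Sum>i\<in>I. y (Some i) * (x \<bullet> a i))"
        unfolding eq(2)[symmetric] using that y(1) by (intro sum_mono mult_left_mono) (auto simp: X_def)
      also have "\<dots> = x \<bullet> (\<Sum>i\<in>I. y (Some i) *\<^sub>R a i)"
        by (simp add: inner_sum_right)
      finally show ?thesis
        by (simp add: eq(1))
    qed
    have "0 < y None"
      using weak X y(1)[of None] by (cases "y None = 0") (auto simp: less_le)
    then have "\<mu> + 1 / y None \<le> x \<bullet> d" if "x \<in> X" for x
      using weak[OF that] by (simp add: field_simps)
    then have "\<mu> + 1 / y None \<le> \<mu>"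
      unfolding \<mu>_def[abs_def] using X by (intro cINF_greatest) (auto simp: \<mu>_def)
    with \<open>0 < y None\<close> show False
      by simp
  qed
  then show thesis
    using lower by (auto simp: X_def intro!: that intro: order_trans)
qed

section \<open>Recession cones and the decomposition of pointed polyhedra\<close>

lemma recession_coneI_closed:
  fixes D :: "'a::real_normed_vector set"
  assumes "closed D" "convex D" "y0 \<in> D" and ray: "\<And>s. 0 \<le> s \<Longrightarrow> y0 + s *\<^sub>R d \<in> D"
  shows "d \<in> recession_cone D"
  unfolding recession_cone_def
proof (intro CollectI ballI allI impI)
  fix y and s :: real assume "y \<in> D" "0 \<le> s"
  \<comment> \<open>A far point of the ray from \<open>y0\<close> gets the small weight
    \<open>1 / Suc n\<close>; the combinations tend to \<open>y + s *\<^sub>R d\<close>.\<close>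
  define u where "u n = (1 - 1 / real (Suc n)) *\<^sub>R y + (1 / real (Suc n)) *\<^sub>R (y0 + (real (Suc n) * s) *\<^sub>R d)" for n
  have uD: "u n \<in> D" for n
    using \<open>y \<in> D\<close> \<open>0 \<le> s\<close> ray[of "real (Suc n) * s"] unfolding u_def
    by (intro convexD[OF \<open>convex D\<close>]) auto
  have u_eq: "u = (\<lambda>n. y + s *\<^sub>R d + (1 / real (Suc n)) *\<^sub>R (y0 - y))"
    by (auto simp: fun_eq_iff u_def algebra_simps simp del: of_nat_Suc)
  have "(\<lambda>n. y + s *\<^sub>R d + (1 / real (Suc n)) *\<^sub>R (y0 - y)) \<longlonglongrightarrow> y + s *\<^sub>R d + 0 *\<^sub>R (y0 - y)"
    by (intro tendsto_intros LIMSEQ_Suc[OF lim_const_over_n[of 1, simplified]])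
  from closed_sequentially[OF \<open>closed D\<close> uD this[folded u_eq]]
  show "y + s *\<^sub>R d \<in> D"
    by simp
qed

lemma convex_cone_recession_cone:
  assumes "convex D"
  shows "convex_cone (recession_cone D)"
  unfolding convex_cone_iff recession_cone_def
  by (auto simp: scaleR_add_right add.assoc[symmetric])

text \<open>The largest admissible parameter works: at a relative interior point the segment from
  \<open>x\<close> could be prolonged.\<close>

lemma line_leaves_closed_convex:
  fixes D :: "'a::euclidean_space set"
  assumes "closed D" "convex D" "x \<in> D" "y \<in> D" "x \<noteq> y"
    and "\<not> (\<forall>s\<ge>0. x + s *\<^sub>R (y - x) \<in> D)"
  obtains s where "1 \<le> s" "x + s *\<^sub>R (y - x) \<in> D" "x + s *\<^sub>R (y - x) \<notin> rel_interior D"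
proof -
  define I where "I = {s. 0 \<le> s \<and> x + s *\<^sub>R (y - x) \<in> D}"
  obtain m where m: "0 \<le> m" "x + m *\<^sub>R (y - x) \<notin> D"
    using assms(6) by blast
  have down: "s' \<in> I" if "s \<in> I" "0 \<le> s'" "s' \<le> s" for s s'
  proof (cases "s = 0")
    case False
    then have "(1 - s' / s) *\<^sub>R x + (s' / s) *\<^sub>R (x + s *\<^sub>R (y - x)) \<in> D"
      using that \<open>x \<in> D\<close> by (intro convexD[OF \<open>convex D\<close>]) (auto simp: I_def)
    also have "(1 - s' / s) *\<^sub>R x + (s' / s) *\<^sub>R (x + s *\<^sub>R (y - x)) = x + s' *\<^sub>R (y - x)"
      using False by (simp add: algebra_simps)
    finally show ?thesis using that by (simp add: I_def)
  qed (use that in auto)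
  have ub: "s \<le> m" if "s \<in> I" for s
    using down[OF that m(1)] m by (fastforce simp: I_def)
  have "I = {0..} \<inter> (\<lambda>s. x + s *\<^sub>R (y - x)) -` D"
    by (auto simp: I_def)
  then have "closed I"
    by (auto intro!: continuous_closed_vimage \<open>closed D\<close> continuous_intros)
  moreover have "1 \<in> I"
    using \<open>y \<in> D\<close> by (simp add: I_def)
  moreover have "bdd_above I"
    using ub by (auto simp: bdd_above_def)
  ultimately have sup: "Sup I \<in> I" "1 \<le> Sup I" "\<And>s. s \<in> I \<Longrightarrow> s \<le> Sup I"
    by (auto intro: closed_contains_Sup cSup_upper)
  let ?z = "x + Sup I *\<^sub>R (y - x)"
  have "?z \<notin> rel_interior D"
  proof
    assume "?z \<in> rel_interior D"
    then obtain e where e: "e > 1" "(1 - e) *\<^sub>R x + e *\<^sub>R ?z \<in> D"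
      using convex_rel_interior_iff[OF \<open>convex D\<close>] \<open>x \<in> D\<close> by blast
    have "(1 - e) *\<^sub>R x + e *\<^sub>R ?z = x + (e * Sup I) *\<^sub>R (y - x)"
      by (simp add: algebra_simps)
    then have "e * Sup I \<in> I"
      using e sup by (simp add: I_def)
    with sup(2,3) e(1) show False
      by (metis less_le_not_le mult_less_cancel_right1 order.trans zero_less_one_class.zero_less_one less_le_trans)
  qed
  with sup show thesis
    by (intro that[of "Sup I"]) (auto simp: I_def)
qed

text \<open>Induction on the dimension of faces. In a face with a second point \<open>y'\<close>,
  each side of the line through \<open>y\<close> and \<open>y'\<close> either leaves through a
  proper face or runs along a recession direction; pointedness excludes the latter on both sides at
  once.\<close>

lemma polyhedron_decomposition:
  fixes D :: "'a::euclidean_space set"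
  assumes "polyhedron D" and pt: "pointed (recession_cone D)" and "y \<in> D"
  obtains v r where "v \<in> convex hull (vertices D)" "r \<in> recession_cone D" "y = v + r"
proof -
  let ?R = "recession_cone D"
  define G where "G = {v + r | v r. v \<in> convex hull (vertices D) \<and> r \<in> ?R}"
  have cD: "closed D" "convex D"
    using assms by (auto simp: polyhedron_imp_closed polyhedron_imp_convex)
  have Rcone: "convex_cone ?R"
    using cD(2) by (rule convex_cone_recession_cone)
  have GR: "g + r \<in> G" if "g \<in> G" "r \<in> ?R" for g r
    using that convex_cone_add[OF Rcone] by (force simp: G_def add.assoc)
  have "convex G"
  proof -
    have "G = (\<Union>v\<in>convex hull (vertices D). \<Union>r\<in>?R. {v + r})"
      by (auto simp: G_def)
    then show ?thesis
      using convex_sums[of "convex hull (vertices D)" ?R] Rcone by (simp add: convex_cone_def)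
  qed
  have main: "F \<subseteq> G" if "F face_of D" for F
    using that
  proof (induction "nat (aff_dim F + 1)" arbitrary: F rule: less_induct)
    case less
    have polyF: "polyhedron F"
      using face_of_polyhedron_polyhedron less.prems \<open>polyhedron D\<close> by blast
    have cF: "closed F" "convex F"
      using polyF by (auto simp: polyhedron_imp_closed polyhedron_imp_convex)
    have FD: "F \<subseteq> D"
      using less.prems by (rule face_of_imp_subset)
    have bd: "z \<in> G" if z: "z \<in> F" "z \<notin> rel_interior F" for z
    proof -
      obtain E where E: "E facet_of F" "z \<in> E"
        using rel_boundary_of_polyhedron[OF polyF] z by blast
      have "E face_of D"
        using E(1) less.prems face_of_trans facet_of_imp_face_of by blast
      moreover have "nat (aff_dim E + 1) < nat (aff_dim F + 1)"
        using E(1) aff_dim_geq[of E] by (auto simp: facet_of_def)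
      ultimately show ?thesis
        using less.hyps E(2) by blast
    qed
    show ?case
    proof
      fix y assume "y \<in> F"
      show "y \<in> G"
      proof (cases "F = {y}")
        case True
        then have "y \<in> vertices D"
          using less.prems by (simp add: vertices_def face_of_singleton)
        then show ?thesis
          using convex_cone_contains_0[OF Rcone] by (force simp: G_def intro: hull_inc)
      next
        case False
        then obtain y' where y': "y' \<in> F" "y' \<noteq> y"
          using \<open>y \<in> F\<close> by blast
        let ?d = "y' - y"
        have ray1: "?d \<in> ?R \<or> (\<exists>s\<ge>1. y + s *\<^sub>R ?d \<in> G)"
        proof (cases "\<forall>s\<ge>0. y + s *\<^sub>R ?d \<in> F")
          case True
          then show ?thesis
            using recession_coneI_closed[OF cD, of y ?d] FD \<open>y \<in> F\<close> by blast
        next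
          case False
          then show ?thesis
            using line_leaves_closed_convex[OF cF \<open>y \<in> F\<close> y'(1) y'(2)[symmetric]] bd by metis
        qed
        have ray2: "- ?d \<in> ?R \<or> (\<exists>s\<ge>1. y' + s *\<^sub>R (- ?d) \<in> G)"
        proof (cases "\<forall>s\<ge>0. y' + s *\<^sub>R (y - y') \<in> F")
          case True
          then show ?thesis
            using recession_coneI_closed[OF cD, of y' "y - y'"] FD \<open>y' \<in> F\<close> by auto
        next
          case False
          then show ?thesis
            using line_leaves_closed_convex[OF cF y'(1) \<open>y \<in> F\<close> y'(2)] bd by (metis minus_diff_eq)
        qed
        have "\<not> (?d \<in> ?R \<and> - ?d \<in> ?R)"
        proof
          assume "?d \<in> ?R \<and> - ?d \<in> ?R"
          then have "?d \<in> ?R \<inter> uminus ` ?R"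
            by (metis IntI image_eqI minus_minus)
          with pt y'(2) show False
            by (auto simp: pointed_def)
        qed
        then consider (fwd) s where "- ?d \<in> ?R" "s \<ge> 1" "y + s *\<^sub>R ?d \<in> G"
          | (bwd) s where "?d \<in> ?R" "s \<ge> 1" "y' + s *\<^sub>R (- ?d) \<in> G"
          | (both) s s' where "s \<ge> 1" "y + s *\<^sub>R ?d \<in> G" "s' \<ge> 1" "y' + s' *\<^sub>R (- ?d) \<in> G"
          using ray1 ray2 by blast
        then show ?thesis
        proof cases
          case fwd
          have "(y + s *\<^sub>R ?d) + s *\<^sub>R (- ?d) \<in> G"
            using fwd(2) by (intro GR[OF fwd(3)] convex_cone_scaleR[OF Rcone _ fwd(1)]) simp
          also have "(y + s *\<^sub>R ?d) + s *\<^sub>R (- ?d) = y"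
            by (simp add: algebra_simps)
          finally show ?thesis .
        next
          case bwd
          have "(y' + s *\<^sub>R (- ?d)) + (s - 1) *\<^sub>R ?d \<in> G"
            using bwd(2) by (intro GR[OF bwd(3)] convex_cone_scaleR[OF Rcone _ bwd(1)]) simp
          also have "(y' + s *\<^sub>R (- ?d)) + (s - 1) *\<^sub>R ?d = y"
            by (simp add: algebra_simps)
          finally show ?thesis .
        next
          case both
          \<comment> \<open>With parameter 0 at \<open>y\<close> and 1 at \<open>y'\<close>, the
            exit points sit at \<open>s\<close> and \<open>1 - s'\<close>; weights proportional to
            \<open>s' - 1\<close> and \<open>s\<close> average them to 0.\<close>
          let ?t = "s + s' - 1"
          have t: "0 < ?t" "(s' - 1) / ?t + s / ?t = 1"
            using both(1,3) by (simp_all add: add_divide_distrib[symmetric])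
          have "((s' - 1) / ?t) *\<^sub>R (y + s *\<^sub>R ?d) + (s / ?t) *\<^sub>R (y' + s' *\<^sub>R (- ?d)) \<in> G"
            using both(1,3) t by (intro convexD[OF \<open>convex G\<close> both(2,4)]) auto
          also have "((s' - 1) / ?t) *\<^sub>R (y + s *\<^sub>R ?d) + (s / ?t) *\<^sub>R (y' + s' *\<^sub>R (- ?d))
            = (1 / ?t) *\<^sub>R ((s' - 1) *\<^sub>R (y + s *\<^sub>R ?d) + s *\<^sub>R (y' + s' *\<^sub>R (- ?d)))"
            by (simp add: scaleR_add_right)
          also have "(s' - 1) *\<^sub>R (y + s *\<^sub>R ?d) + s *\<^sub>R (y' + s' *\<^sub>R (- ?d)) = ?t *\<^sub>R y"
            by (simp add: algebra_simps)
          finally show ?thesis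
            using t(1) by simp
        qed
      qed
    qed
  qed
  show thesis
    using main[OF face_of_refl[OF cD(2)]] \<open>y \<in> D\<close> that by (auto simp: G_def)
qed

section \<open>Outer approximations and the primal algorithm\<close>

lemma correct_and_finiteI:
  assumes init: "Inv init" and "wf r"
    and step: "\<And>s s'. Inv s \<Longrightarrow> step s s' \<Longrightarrow> Inv s' \<and> (s', s) \<in> r"
    and progress: "\<And>s. Inv s \<Longrightarrow> (\<exists>x. s = ret x) \<or> (\<exists>s'. step s s')"
    and spec: "\<And>x. Inv (ret x) \<Longrightarrow> spec x"
  shows "correct_and_finite step init ret spec"
proof -
  have reach: "Inv s" if "step\<^sup>*\<^sup>* init s" for s
    using that by induction (use init step in blast)+
  have "\<not> (\<sigma> 0 = init \<and> (\<forall>i. step (\<sigma> i) (\<sigma> (Suc i))))" for \<sigma>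
  proof
    assume \<sigma>: "\<sigma> 0 = init \<and> (\<forall>i. step (\<sigma> i) (\<sigma> (Suc i)))"
    have "Inv (\<sigma> i)" for i
      by (induction i) (use \<sigma> init step in auto)
    then have "\<forall>i. (\<sigma> (Suc i), \<sigma> i) \<in> r"
      using \<sigma> step by blast
    with \<open>wf r\<close> show False
      by (auto simp: wf_iff_no_infinite_down_chain)
  qed
  with reach progress spec show ?thesis
    unfolding correct_and_finite_def by blast
qed

lemma ex_is_arg_min_finite:
  fixes g :: "'a \<Rightarrow> 'b::linorder"
  assumes "finite X" "X \<noteq> {}"
  shows "\<exists>t. is_arg_min g (\<lambda>y. y \<in> X) t"
  using ex_is_arg_min_if_finite[OF assms, of g] by simp

lemma polyhedron_Collect_all_ge:
  fixes a :: "'i::finite \<Rightarrow> 'a::euclidean_space"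
  shows "polyhedron {x. \<forall>i. \<beta> i \<le> a i \<bullet> x}"
proof -
  have "{x. \<forall>i. \<beta> i \<le> a i \<bullet> x} = \<Inter> (range (\<lambda>i. {x. \<beta> i \<le> a i \<bullet> x}))"
    by auto
  moreover have "polyhedron (\<Inter> (range (\<lambda>i. {x. \<beta> i \<le> a i \<bullet> x})))"
    using polyhedron_halfspace_ge[where 'a = 'a] by (intro polyhedron_Inter) auto
  ultimately show ?thesis
    by metis
qed

lemma polyhedron_feasible: "polyhedron (feasible A b)"
proof -
  have "feasible A b = {x. \<forall>i. b $ i \<le> A $ i \<bullet> x}"
    by (simp add: feasible_def less_eq_vec_def matrix_vector_mul_component)
  then show ?thesis
    by (simp add: polyhedron_Collect_all_ge)
qed

lemma inner_transpose_mult: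
  fixes B :: "real ^ 'a ^ 'b"
  shows "w \<bullet> (B *v x) = (transpose B *v w) \<bullet> x"
  by (simp add: transpose_matrix_vector dot_lmul_matrix)

lemma transpose_mult_nth:
  fixes B :: "real ^ 'a ^ 'b"
  shows "(transpose B *v y) $ j = column j B \<bullet> y"
  by (simp add: matrix_vector_mul_component row_def column_def transpose_def)

lemma transpose_mult_sum:
  fixes B :: "real ^ 'a ^ 'b"
  shows "transpose B *v u = (\<Sum>i\<in>UNIV. u $ i *\<^sub>R B $ i)"
  by (simp add: matrix_mult_sum column_transpose row_def scalar_mult_eq_scaleR)

lemma P1_optimal_iff:
  "P1_optimal A b M w x \<longleftrightarrow>
    x \<in> feasible A b \<and> (\<forall>x'\<in>feasible A b. w \<bullet> (M *v x) \<le> w \<bullet> (M *v x'))"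
  by (auto simp: P1_optimal_def is_arg_min_linorder feasible_def)

lemma nonneg_slope:
  fixes \<alpha> \<beta> :: real
  assumes "\<And>s. 0 \<le> s \<Longrightarrow> 0 \<le> \<alpha> + s * \<beta>"
  shows "0 \<le> \<beta>"
proof (rule ccontr)
  assume "\<not> 0 \<le> \<beta>"
  then have "0 \<le> (\<bar>\<alpha>\<bar> + 1) / - \<beta>" "(\<bar>\<alpha>\<bar> + 1) / - \<beta> * \<beta> = - \<bar>\<alpha>\<bar> - 1"
    by (simp_all add: divide_nonneg_neg)
  then show False
    using assms[of "(\<bar>\<alpha>\<bar> + 1) / - \<beta>"] by linarith
qed

text \<open>The special shape of the reformulation is forgotten: \<open>M\<close>, \<open>F\<close>,
  \<open>K\<close> will be \<open>P_bar P\<close>, \<open>f_bar f\<close>, \<open>R_cone Y\<close>.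
  The cone is described twice because the primal program tests membership by \<open>Z\<close>, while
  its dual tests dual membership on the generators \<open>V\<close>.\<close>

locale vector_program =
  fixes A :: "real ^ 'n ^ 'm" and b :: "real ^ 'm" and M :: "real ^ 'n ^ 'p"
    and F :: "real ^ 'p \<Rightarrow> ereal" and V :: "real ^ 'v ^ 'p" and Z :: "real ^ 'z ^ 'p"
    and c :: "real ^ 'p" and K :: "(real ^ 'p) set"
  assumes feasible_nonempty: "feasible A b \<noteq> {}"
    and quasi_concave_F: "quasi_concave F"
    and pointed_K: "pointed K"
    and monotone_F: "cone_monotone_on K {M *v x - k | x k. x \<in> feasible A b \<and> k \<in> K} F"
    and K_generated: "K = generated_cone V"
    and K_inequalities: "K = {y. 0 \<le> transpose Z *v y}"
    and c_interior: "c \<in> interior K"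
begin

abbreviation "S \<equiv> feasible A b"

section \<open>The dual cone and its normalised elements\<close>

definition dual_cone :: "(real ^ 'p) set" where
  "dual_cone = {w. \<forall>k\<in>K. 0 \<le> w \<bullet> k}"

lemma K_iff: "y \<in> K \<longleftrightarrow> (\<forall>j. 0 \<le> column j Z \<bullet> y)"
  by (simp add: K_inequalities less_eq_vec_def transpose_mult_nth del: transpose_matrix_vector)

lemma K_add: "y \<in> K \<Longrightarrow> y' \<in> K \<Longrightarrow> y + y' \<in> K"
  by (simp add: K_iff inner_add_right)

lemma K_scale: "y \<in> K \<Longrightarrow> 0 \<le> s \<Longrightarrow> s *\<^sub>R y \<in> K"
  by (simp add: K_iff)

lemma K_zero: "0 \<in> K"
  by (simp add: K_iff)

lemma c_in_K: "c \<in> K"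
  using c_interior interior_subset by blast

lemma polyhedron_K: "polyhedron K"
proof -
  have "K = {y. \<forall>j. 0 \<le> column j Z \<bullet> y}"
    by (auto simp: K_iff)
  then show ?thesis
    using polyhedron_Collect_all_ge[of "\<lambda>_. 0" "\<lambda>j. column j Z"] by simp
qed

lemma dual_cone_iff: "w \<in> dual_cone \<longleftrightarrow> (\<forall>j. 0 \<le> column j V \<bullet> w)"
proof
  assume w: "w \<in> dual_cone"
  show "\<forall>j. 0 \<le> column j V \<bullet> w"
  proof
    fix j
    have "column j V = V *v axis j 1"
      by (simp add: matrix_vector_mult_basis)
    moreover have "0 \<le> (axis j 1 :: real ^ 'v)"
      by (simp add: less_eq_vec_def axis_def)
    ultimately have "column j V \<in> K"
      unfolding K_generated generated_cone_def by blast
    with w show "0 \<le> column j V \<bullet> w"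
      by (auto simp: dual_cone_def inner_commute)
  qed
next
  assume w: "\<forall>j. 0 \<le> column j V \<bullet> w"
  have "0 \<le> w \<bullet> (V *v \<mu>)" if "0 \<le> \<mu>" for \<mu>
    using w that unfolding inner_transpose_mult inner_vec_def[of "transpose V *v w"]
    by (intro sum_nonneg) (simp add: transpose_mult_nth less_eq_vec_def del: transpose_matrix_vector)
  then show "w \<in> dual_cone"
    unfolding dual_cone_def by (subst K_generated) (auto simp: generated_cone_def)
qed

lemma column_Z_dual: "column j Z \<in> dual_cone"
  by (simp add: dual_cone_def K_iff)

text \<open>A ball of radius \<open>e\<close> around \<open>c\<close> lies in \<open>K\<close>;
  stepping from \<open>c\<close> against \<open>w\<close> by \<open>e\<close> stays in
  \<open>K\<close>, which forces \<open>w \<bullet> c\<close> to be at least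
  \<open>e * norm w\<close>.\<close>

lemma dual_cone_pos:
  assumes "w \<in> dual_cone" "w \<noteq> 0"
  shows "0 < w \<bullet> c"
proof -
  obtain e where e: "0 < e" "cball c e \<subseteq> K"
    using c_interior mem_interior_cball by blast
  let ?k = "c - (e / norm w) *\<^sub>R w"
  have "?k \<in> K"
    using e assms(2) by (intro subsetD[OF e(2)]) (simp add: dist_norm)
  then have "0 \<le> w \<bullet> ?k"
    using assms(1) by (simp add: dual_cone_def)
  then have "e / norm w * (w \<bullet> w) \<le> w \<bullet> c"
    by (simp add: inner_diff_right)
  moreover have "0 < e / norm w * (w \<bullet> w)"
    using e(1) assms(2) by simp
  ultimately show ?thesis
    by linarith
qed

text \<open>This justifies the division in the start of the dual algorithm. If every column
  vanished, \<open>K\<close> would be the whole space and not pointed.\<close>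

lemma sum_column_Z_pos: "0 < (\<Sum>j\<in>UNIV. column j Z) \<bullet> c"
proof -
  obtain v :: "real ^ 'p" where "v \<noteq> 0"
    using vector_choose_size[of 1] by (metis norm_zero zero_le_one zero_neq_one)
  then have "v \<notin> K \<inter> uminus ` K"
    using pointed_K by (simp add: pointed_def)
  moreover have "v \<in> K" "- v \<in> K" if "\<forall>j. column j Z = 0"
    using that by (simp_all add: K_iff)
  ultimately obtain j where j: "column j Z \<noteq> 0"
    by (metis IntI image_eqI minus_minus)
  have "0 \<le> column i Z \<bullet> c" for i
    using column_Z_dual c_in_K by (auto simp: dual_cone_def)
  moreover have "0 < column j Z \<bullet> c"
    using dual_cone_pos[OF column_Z_dual j] .
  ultimately have "0 < (\<Sum>j\<in>UNIV. column j Z \<bullet> c)"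
    by (intro sum_pos2[of _ j]) auto
  then show ?thesis
    by (simp add: inner_sum_left)
qed

text \<open>The starting weight of the dual algorithm; it is also the functional that bounds the
  programs \<open>P2\<close> from below.\<close>

definition base_point :: "real ^ 'p" where
  "base_point = inverse (c \<bullet> (\<Sum>j\<in>UNIV. column j Z)) *\<^sub>R (\<Sum>j\<in>UNIV. column j Z)"

lemma base_point: "base_point \<in> dual_cone" "base_point \<bullet> c = 1"
  using sum_column_Z_pos column_Z_dual
  by (auto simp: base_point_def dual_cone_def inner_sum_left inner_commute[of c] intro!: sum_nonneg mult_nonneg_nonneg)

text \<open>\<open>P2\<close> asks how far \<open>t\<close> must be pushed along \<open>c\<close> to
  reach the image plus \<open>K\<close>. Since \<open>c\<close> is interior, this is possible from
  every \<open>t\<close>.\<close>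

lemma absorb_into_K: "\<exists>s. y + s *\<^sub>R c \<in> K"
proof (cases "y = 0")
  case True
  then show ?thesis
    using c_in_K by (metis add_0 scaleR_one)
next
  case False
  obtain e where e: "0 < e" "cball c e \<subseteq> K"
    using c_interior mem_interior_cball by blast
  have "c + (e / norm y) *\<^sub>R y \<in> K"
    using e False by (intro subsetD[OF e(2)]) (simp add: dist_norm)
  then have "(norm y / e) *\<^sub>R (c + (e / norm y) *\<^sub>R y) \<in> K"
    using e(1) by (intro K_scale) auto
  then show ?thesis
    using e(1) False by (auto simp: scaleR_add_right add.commute)
qed

text \<open>The property that all primal cuts preserve. Keeping the recession cone equal to the
  pointed cone \<open>K\<close> guarantees vertices, and lower bounds for all functionals in
  \<open>dual_cone\<close>.\<close>

definition outer :: "(real ^ 'p) set \<Rightarrow> bool" where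
  "outer Q \<longleftrightarrow> polyhedron Q \<and> (\<forall>x\<in>S. \<forall>k\<in>K. M *v x + k \<in> Q) \<and> recession_cone Q = K"

lemma outer_image: "outer Q \<Longrightarrow> x \<in> S \<Longrightarrow> M *v x \<in> Q"
  unfolding outer_def using K_zero by (metis add.right_neutral)

lemma outer_add:
  assumes "outer Q" "y \<in> Q" "k \<in> K"
  shows "y + k \<in> Q"
proof -
  have "k \<in> recession_cone Q"
    using assms by (simp add: outer_def)
  then have "y + 1 *\<^sub>R k \<in> Q"
    using assms(2) zero_le_one unfolding recession_cone_def by blast
  then show ?thesis
    by simp
qed

lemma outer_decomposition:
  assumes "outer Q" "y \<in> Q"
  obtains v k where "v \<in> convex hull (vertices Q)" "k \<in> K" "y = v + k"
  using polyhedron_decomposition[of Q y] assms pointed_K by (auto simp: outer_def)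

lemma outer_finite_vertices: "outer Q \<Longrightarrow> finite (vertices Q)"
  by (simp add: outer_def vertices_def finite_polyhedron_extreme_points)

lemma outer_vertices_nonempty:
  assumes "outer Q"
  shows "vertices Q \<noteq> {}"
proof -
  obtain x where "x \<in> S"
    using feasible_nonempty by blast
  from outer_decomposition[OF assms outer_image[OF assms this]]
  obtain v where "v \<in> convex hull (vertices Q)" .
  then show ?thesis
    by auto
qed

lemma vertices_subset: "vertices Q \<subseteq> Q"
  by (auto simp: vertices_def extreme_point_of_def)

text \<open>Vertices decide the bound, since the \<open>K\<close> part of the decomposition
  contributes a nonnegative amount. Attainment in the linear programs below rests on this.\<close>

lemma outer_bounded_below:
  assumes "outer Q" "w \<in> dual_cone"
  obtains \<gamma> where "\<And>y. y \<in> Q \<Longrightarrow> \<gamma> \<le> w \<bullet> y"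
proof -
  let ?\<gamma> = "Min ((\<bullet>) w ` vertices Q)"
  have hull: "convex hull (vertices Q) \<subseteq> {y. ?\<gamma> \<le> w \<bullet> y}"
    using outer_finite_vertices[OF assms(1)] by (intro hull_minimal convex_halfspace_ge) auto
  have "?\<gamma> \<le> w \<bullet> y" if y: "y \<in> Q" for y
  proof -
    obtain v k where "v \<in> convex hull (vertices Q)" "k \<in> K" "y = v + k"
      using outer_decomposition[OF assms(1) y] .
    moreover have "?\<gamma> \<le> w \<bullet> v" "0 \<le> w \<bullet> k"
      using hull calculation assms(2) by (auto simp: dual_cone_def)
    ultimately show ?thesis
      by (simp add: inner_add_right)
  qed
  then show thesis ..
qed

text \<open>A normal in \<open>dual_cone\<close> excludes no direction of \<open>K\<close>.
  Conversely, a ray of the smaller set that starts at an image point is a ray of the closed convex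
  set \<open>Q\<close>, which makes its direction a recession direction of \<open>Q\<close>.\<close>

lemma outer_Int_halfspace:
  assumes "outer Q" "w \<in> dual_cone" and valid: "\<And>x. x \<in> S \<Longrightarrow> \<gamma> \<le> w \<bullet> (M *v x)"
  shows "outer (Q \<inter> {y. \<gamma> \<le> w \<bullet> y})"
  unfolding outer_def
proof (intro conjI ballI)
  let ?Q = "Q \<inter> {y. \<gamma> \<le> w \<bullet> y}"
  show poly: "polyhedron ?Q"
    using assms(1) by (simp add: outer_def polyhedron_halfspace_ge)
  show image: "M *v x + k \<in> ?Q" if "x \<in> S" "k \<in> K" for x k
    using assms that by (auto simp: outer_def dual_cone_def inner_add_right intro: add_increasing2)
  show "recession_cone ?Q = K"
  proof
    show "K \<subseteq> recession_cone ?Q"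
      using outer_add[OF assms(1) _ K_scale] assms(2)
      by (auto simp: recession_cone_def dual_cone_def inner_add_right intro: add_increasing2)
    obtain x0 where "x0 \<in> S"
      using feasible_nonempty by blast
    then have "M *v x0 \<in> ?Q"
      using image[OF _ K_zero] by simp
    moreover have "closed Q" "convex Q" "recession_cone Q = K"
      using assms(1) by (auto simp: outer_def polyhedron_imp_closed polyhedron_imp_convex)
    ultimately show "recession_cone ?Q \<subseteq> K"
      using recession_coneI_closed[of Q "M *v x0"] by (force simp: recession_cone_def[of ?Q])
  qed
qed

text \<open>Scaling a ball of radius \<open>e\<close> around \<open>c\<close> by \<open>s\<close>
  shows that \<open>y + K\<close> contains the ball of radius \<open>s * e\<close> around the
  point.\<close>

lemma outer_add_interior:
  assumes "outer Q" "y \<in> Q" "0 < s"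
  shows "y + s *\<^sub>R c \<in> interior Q"
proof -
  obtain e where e: "0 < e" "ball c e \<subseteq> K"
    using c_interior mem_interior by blast
  have "z \<in> Q" if "z \<in> ball (y + s *\<^sub>R c) (s * e)" for z
  proof -
    have "c - (1 / s) *\<^sub>R (z - y) = (1 / s) *\<^sub>R (y + s *\<^sub>R c - z)"
      using assms(3) by (simp add: algebra_simps)
    then have "dist c ((1 / s) *\<^sub>R (z - y)) = dist (y + s *\<^sub>R c) z / s"
      using assms(3) unfolding dist_norm by simp
    then have "(1 / s) *\<^sub>R (z - y) \<in> ball c e"
      using that assms(3) by (simp add: divide_less_eq mult.commute)
    then have "(1 / s) *\<^sub>R (z - y) \<in> K"
      using e(2) by blast
    from outer_add[OF assms(1,2) K_scale[OF this less_imp_le[OF assms(3)]]]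
    have "y + s *\<^sub>R ((1 / s) *\<^sub>R (z - y)) \<in> Q" .
    then show ?thesis
      using assms(3) by simp
  qed
  then show ?thesis
    using assms(3) e(1) by (auto simp: mem_interior intro!: exI[of _ "s * e"])
qed

text \<open>Otherwise \<open>t\<close> would be the midpoint of \<open>M *v x\<close> and
  \<open>t + (t - M *v x)\<close>, both of which lie in \<open>Q\<close>.\<close>

lemma vertex_above_image:
  assumes "outer Q" "t \<in> vertices Q" "x \<in> S" "t - M *v x \<in> K"
  shows "t = M *v x"
proof (rule ccontr)
  let ?k = "t - M *v x"
  assume "t \<noteq> M *v x"
  then have "M *v x \<noteq> t + ?k"
    by (simp add: algebra_simps flip: scaleR_2)
  then have "t \<in> open_segment (M *v x) (t + ?k)"
    unfolding in_segment by (intro conjI exI[of _ "1 / 2"]) (simp_all add: algebra_simps flip: scaleR_2)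
  moreover have "M *v x \<in> Q" "t + ?k \<in> Q"
    using assms outer_image outer_add vertices_subset by blast+
  ultimately show False
    using assms(2) by (auto simp: vertices_def extreme_point_of_def)
qed

text \<open>Every \<open>M *v x'\<close> dominates a convex combination of vertices, so quasi-concavity and
  monotonicity make the best vertex a lower bound.\<close>

lemma optimal_at_vertex:
  assumes "outer Q" and t: "is_arg_min F (\<lambda>y. y \<in> vertices Q) t" and "x \<in> S" "t = M *v x"
  shows "is_arg_min (\<lambda>x. F (M *v x)) (\<lambda>x. x \<in> S) x"
proof -
  have "F t \<le> F (M *v x')" if x': "x' \<in> S" for x'
  proof -
    obtain v k where v: "v \<in> convex hull (vertices Q)" "k \<in> K" "M *v x' = v + k"
      using outer_decomposition[OF assms(1) outer_image[OF assms(1) x']] .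
    have "F v \<le> F (M *v x')"
    proof -
      have "v \<in> {M *v x - k | x k. x \<in> S \<and> k \<in> K}"
        using v x' by (auto intro!: exI[of _ x'] exI[of _ k])
      moreover have "M *v x' \<in> {M *v x - k | x k. x \<in> S \<and> k \<in> K}"
        using x' K_zero by (intro CollectI exI[of _ x'] exI[of _ 0]) simp
      moreover have "M *v x' - v \<in> K"
        using v by simp
      ultimately show ?thesis
        using monotone_F unfolding cone_monotone_on_def by blast
    qed
    moreover have "F t \<le> F v"
    proof (rule ccontr)
      assume "\<not> F t \<le> F v"
      \<comment> \<open>Quasi-concavity concerns real levels only, while \<open>F\<close> may be
        infinite; hence a real number strictly in between.\<close>
      then obtain r where r: "F v < ereal r" "ereal r < F t"
        using ereal_dense2[of "F v" "F t"] by (auto simp: not_le)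
      then have "vertices Q \<subseteq> {y. ereal r \<le> F y}"
        using t by (auto simp: is_arg_min_linorder intro: order_trans less_imp_le)
      then have "convex hull (vertices Q) \<subseteq> {y. ereal r \<le> F y}"
        using quasi_concave_F by (intro hull_minimal) (auto simp: quasi_concave_def)
      with v(1) r(1) show False
        by (auto simp: not_le[symmetric])
    qed
    ultimately show ?thesis
      by order
  qed
  with assms(3,4) show ?thesis
    by (simp add: is_arg_min_linorder)
qed

section \<open>Linear programming duality between \<open>P2\<close> and \<open>D2\<close>\<close>

lemma P2_feasible_iff:
  "P2_feasible A b M Z c t (x, z) \<longleftrightarrow> x \<in> S \<and> t + z *\<^sub>R c - M *v x \<in> K"
  unfolding K_inequalities P2_feasible_def feasible_def
  by (simp add: matrix_vector_right_distrib matrix_vector_mult_diff_distrib matrix_vector_mult_scaleR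
      del: transpose_matrix_vector)

lemma D2_feasible_iff:
  "D2_feasible A M V c (u, w) \<longleftrightarrow>
    transpose A *v u = transpose M *v w \<and> w \<bullet> c = 1 \<and> w \<in> dual_cone \<and> 0 \<le> u"
  by (auto simp: D2_feasible_def dual_cone_iff less_eq_vec_def transpose_mult_nth inner_commute
      simp del: transpose_matrix_vector)

lemma D2_feasible_valid:
  assumes "D2_feasible A M V c (u, w)" "x \<in> S"
  shows "b \<bullet> u \<le> w \<bullet> (M *v x)"
proof -
  have "b \<bullet> u \<le> (A *v x) \<bullet> u"
    using assms unfolding inner_vec_def inner_real_def
    by (intro sum_mono mult_right_mono) (auto simp: D2_feasible_iff feasible_def less_eq_vec_def)
  also have "\<dots> = (transpose A *v u) \<bullet> x"
    by (simp only: inner_commute[of "A *v x"] inner_transpose_mult)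
  also have "\<dots> = w \<bullet> (M *v x)"
    using assms(1) by (simp only: D2_feasible_iff inner_transpose_mult)
  finally show ?thesis .
qed

lemma weak_duality:
  assumes "P2_feasible A b M Z c t (x, z)" "D2_feasible A M V c (u, w)"
  shows "b \<bullet> u - t \<bullet> w \<le> z"
proof -
  have "0 \<le> w \<bullet> (t + z *\<^sub>R c - M *v x)" "w \<bullet> c = 1" "x \<in> S"
    using assms by (auto simp: P2_feasible_iff D2_feasible_iff dual_cone_def)
  with D2_feasible_valid[OF assms(2), of x] show ?thesis
    by (simp add: inner_diff_right inner_add_right inner_commute[of t])
qed

text \<open>The outer set bounds \<open>P2\<close> from below through \<open>base_point\<close>, so
  an optimum is attained; the Farkas multipliers certifying its value are then converted into a
  feasible point of \<open>D2\<close>.\<close>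

lemma strong_duality:
  assumes "outer Q"
  obtains x z u w where "P2_optimal A b M Z c t (x, z)" "D2_feasible A M V c (u, w)"
    "z \<le> b \<bullet> u - t \<bullet> w"
proof -
  \<comment> \<open>The constraints of \<open>P2\<close> in the variable \<open>(x, z)\<close>:
    \<open>Inl\<close> for the rows of \<open>A\<close>, \<open>Inr\<close> for the inequalities
    describing \<open>K\<close>.\<close>
  define a :: "'m + 'z \<Rightarrow> (real ^ 'n) \<times> real" where
    "a = (\<lambda>i. case i of Inl i \<Rightarrow> (A $ i, 0)
      | Inr j \<Rightarrow> (- (transpose M *v column j Z), column j Z \<bullet> c))"
  define \<beta> :: "'m + 'z \<Rightarrow> real" where
    "\<beta> = (\<lambda>i. case i of Inl i \<Rightarrow> b $ i | Inr j \<Rightarrow> - (column j Z \<bullet> t))"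
  have feas: "(\<forall>i\<in>UNIV. \<beta> i \<le> (x, z) \<bullet> a i) \<longleftrightarrow> P2_feasible A b M Z c t (x, z)" for x z
  proof -
    have "\<beta> (Inr j) \<le> (x, z) \<bullet> a (Inr j) \<longleftrightarrow> 0 \<le> column j Z \<bullet> (t + z *\<^sub>R c - M *v x)" for j
      unfolding inner_add_right inner_diff_right inner_transpose_mult
      by (auto simp: a_def \<beta>_def inner_commute[of x] simp del: transpose_matrix_vector)
    moreover have "\<beta> (Inl i) \<le> (x, z) \<bullet> a (Inl i) \<longleftrightarrow> b $ i \<le> (A *v x) $ i" for i
      by (simp add: a_def \<beta>_def matrix_vector_mul_component inner_commute)
    ultimately show ?thesis
      unfolding P2_feasible_iff K_iff feasible_def less_eq_vec_def UNIV_sum by (simp add: ball_Un)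
  qed
  obtain x0 where "x0 \<in> S"
    using feasible_nonempty by blast
  moreover obtain z0 where "(t - M *v x0) + z0 *\<^sub>R c \<in> K"
    using absorb_into_K by blast
  ultimately have "P2_feasible A b M Z c t (x0, z0)"
    by (simp add: P2_feasible_iff algebra_simps)
  with feas have ne: "\<forall>i\<in>UNIV. \<beta> i \<le> (x0, z0) \<bullet> a i"
    by blast
  obtain \<gamma> where \<gamma>: "\<And>y. y \<in> Q \<Longrightarrow> \<gamma> \<le> base_point \<bullet> y"
    using outer_bounded_below[OF assms base_point(1)] by blast
  have below: "\<gamma> - base_point \<bullet> t \<le> xz \<bullet> (0, 1)" if xz: "\<forall>i\<in>UNIV. \<beta> i \<le> xz \<bullet> a i" for xz
  proof -
    obtain x z where [simp]: "xz = (x, z)"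
      by fastforce
    have "x \<in> S" "t + z *\<^sub>R c - M *v x \<in> K"
      using xz feas by (auto simp: P2_feasible_iff)
    then have "\<gamma> \<le> base_point \<bullet> (M *v x)" "0 \<le> base_point \<bullet> (t + z *\<^sub>R c - M *v x)"
      using \<gamma> outer_image[OF assms] base_point(1) by (auto simp: dual_cone_def)
    then show ?thesis
      using base_point(2) by (simp add: inner_diff_right inner_add_right)
  qed
  obtain xz where xz: "\<forall>i\<in>UNIV. \<beta> i \<le> xz \<bullet> a i"
    "\<And>xz'. \<forall>i\<in>UNIV. \<beta> i \<le> xz' \<bullet> a i \<Longrightarrow> xz \<bullet> (0, 1) \<le> xz' \<bullet> (0, 1)"
    using LP_attains[OF finite ne below] by blast
  obtain x z where [simp]: "xz = (x, z)"
    by fastforce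
  have P2: "P2_optimal A b M Z c t (x, z)"
    unfolding P2_optimal_def is_arg_min_linorder
  proof (intro conjI allI impI)
    show "P2_feasible A b M Z c t (x, z)"
      using xz(1) feas by simp
    fix xz' assume "P2_feasible A b M Z c t xz'"
    then show "(case (x, z) of (x, z) \<Rightarrow> z) \<le> (case xz' of (x, z) \<Rightarrow> z)"
      using xz(2)[of xz'] feas by (cases xz') simp
  qed
  obtain y where y: "\<And>i. 0 \<le> y i" "(\<Sum>i\<in>UNIV. y i *\<^sub>R a i) = (0, 1)"
    "z \<le> (\<Sum>i\<in>UNIV. y i * \<beta> i)"
    using affine_farkas[OF finite ne, of z "(0, 1)"] xz(2) by auto
  define u where "u = (\<chi> i. y (Inl i))"
  \<comment> \<open>The multipliers of the cone inequalities collapse into one vector of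
    \<open>dual_cone\<close>. The two components of the identity for \<open>(0, 1)\<close> become
    the equations of \<open>D2\<close>.\<close>
  define w where "w = (\<Sum>j\<in>UNIV. y (Inr j) *\<^sub>R column j Z)"
  have split: "(\<Sum>i\<in>UNIV. h i) = (\<Sum>i\<in>UNIV. h (Inl i)) + (\<Sum>j\<in>UNIV. h (Inr j))"
    for h :: "'m + 'z \<Rightarrow> 'w::comm_monoid_add"
    by (subst UNIV_Plus_UNIV[symmetric], subst sum.Plus) auto
  have "transpose A *v u - transpose M *v w = fst (\<Sum>i\<in>UNIV. y i *\<^sub>R a i)"
    unfolding split transpose_mult_sum[of A]
    by (simp add: fst_sum u_def w_def a_def linear_sum[OF matrix_vector_mul_linear] matrix_vector_mult_scaleR
        sum_negf del: transpose_matrix_vector)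
  then have "transpose A *v u = transpose M *v w"
    by (simp add: y(2) del: transpose_matrix_vector)
  moreover have "w \<bullet> c = snd (\<Sum>i\<in>UNIV. y i *\<^sub>R a i)"
    unfolding split by (simp add: snd_sum w_def a_def inner_sum_left)
  then have "w \<bullet> c = 1"
    by (simp add: y(2))
  moreover have "w \<in> dual_cone"
    using y(1) column_Z_dual
    by (auto simp: w_def dual_cone_def inner_sum_left intro!: sum_nonneg mult_nonneg_nonneg)
  moreover have "0 \<le> u"
    using y(1) by (simp add: u_def less_eq_vec_def)
  ultimately have D2: "D2_feasible A M V c (u, w)"
    by (simp add: D2_feasible_iff)
  have "(\<Sum>i\<in>UNIV. y i * \<beta> i) = b \<bullet> u - t \<bullet> w"
    unfolding split
    by (simp add: \<beta>_def u_def w_def inner_sum_right inner_vec_def[of b] sum_negf mult.commute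
        inner_commute[of t])
  with y(3) P2 D2 that show thesis
    by simp
qed

lemma ex_P2_optimal: "outer Q \<Longrightarrow> \<exists>xz. P2_optimal A b M Z c t xz"
  using strong_duality by metis

lemma ex_D2_optimal:
  assumes "outer Q"
  shows "\<exists>uw. D2_optimal A b M V c t uw"
proof -
  obtain x z u w where *: "P2_optimal A b M Z c t (x, z)" "D2_feasible A M V c (u, w)"
    "z \<le> b \<bullet> u - t \<bullet> w"
    using strong_duality[OF assms] .
  have "b \<bullet> u' - t \<bullet> w' \<le> b \<bullet> u - t \<bullet> w" if "D2_feasible A M V c (u', w')" for u' w'
    using weak_duality[OF _ that] * by (force simp: P2_optimal_def is_arg_min_linorder)
  with *(2) have "D2_optimal A b M V c t (u, w)"
    by (auto simp: D2_optimal_def is_arg_max_linorder)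
  then show ?thesis ..
qed

lemma optimal_values_eq:
  assumes "outer Q" "P2_optimal A b M Z c t (x, z)" "D2_optimal A b M V c t (u, w)"
  shows "b \<bullet> u - t \<bullet> w = z"
proof -
  obtain x' z' u' w' where *: "P2_optimal A b M Z c t (x', z')" "D2_feasible A M V c (u', w')"
    "z' \<le> b \<bullet> u' - t \<bullet> w'"
    using strong_duality[OF assms(1)] .
  have "b \<bullet> u - t \<bullet> w \<le> z"
    using assms(2,3) by (intro weak_duality)
      (auto simp: P2_optimal_def is_arg_min_linorder D2_optimal_def is_arg_max_linorder)
  moreover have "z \<le> z'"
    using assms(2) *(1) by (fastforce simp: P2_optimal_def is_arg_min_linorder)
  moreover have "b \<bullet> u' - t \<bullet> w' \<le> b \<bullet> u - t \<bullet> w"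
    using assms(3) *(2) by (fastforce simp: D2_optimal_def is_arg_max_linorder)
  ultimately show ?thesis
    using *(3) by linarith
qed

lemma D2_cut:
  assumes "outer Q" "D2_optimal A b M V c t (u, w)"
  shows "outer (Q \<inter> {y. b \<bullet> u \<le> w \<bullet> y})"
proof -
  have "D2_feasible A M V c (u, w)"
    using assms(2) by (simp add: D2_optimal_def is_arg_max_linorder)
  then show ?thesis
    using assms(1) D2_feasible_valid by (intro outer_Int_halfspace) (auto simp: D2_feasible_iff)
qed

text \<open>The interior matters here: the cut exposing \<open>G\<close> and \<open>H\<close> may
  keep sums of their points in the set, but only on its boundary.\<close>

definition live_faces :: "(real ^ 'p) set \<Rightarrow> ((real ^ 'n) set \<times> (real ^ 'p) set) set" where
  "live_faces Q = {(G, H). G face_of S \<and> H face_of K \<and> (\<exists>x\<in>G. \<exists>k\<in>H. M *v x + k \<in> interior Q)}"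

lemma finite_live_faces: "finite (live_faces Q)"
proof (rule finite_subset)
  show "live_faces Q \<subseteq> {G. G face_of S} \<times> {H. H face_of K}"
    by (auto simp: live_faces_def)
  show "finite ({G. G face_of S} \<times> {H. H face_of K})"
    using polyhedron_feasible polyhedron_K by (intro finite_cartesian_product finite_polyhedron_faces)
qed

text \<open>Since \<open>t + z c\<close> is an interior point of \<open>Q\<close> lying on the new supporting hyperplane, the
  pair of faces exposed by \<open>w\<close> is met in the interior of \<open>Q\<close> before the cut, but not afterwards.\<close>

lemma primal_cut_decreases:
  assumes "outer Q" "t \<in> Q" and P2: "P2_optimal A b M Z c t (x, z)"
    and D2: "D2_optimal A b M V c t (u, w)" and "0 < z"
  shows "card (live_faces (Q \<inter> {y. b \<bullet> u \<le> w \<bullet> y})) < card (live_faces Q)"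
proof (rule psubset_card_mono[OF finite_live_faces psubsetI])
  let ?H = "{y. b \<bullet> u \<le> w \<bullet> y}"
  have "interior (Q \<inter> ?H) \<subseteq> interior Q"
    by (intro interior_mono) auto
  then show "live_faces (Q \<inter> ?H) \<subseteq> live_faces Q"
    by (auto simp: live_faces_def)
  have D2f: "D2_feasible A M V c (u, w)"
    using D2 by (simp add: D2_optimal_def is_arg_max_linorder)
  then have w: "w \<bullet> c = 1" "w \<in> dual_cone"
    by (auto simp: D2_feasible_iff)
  have P2f: "x \<in> S" "t + z *\<^sub>R c - M *v x \<in> K"
    using P2 by (auto simp: P2_optimal_def is_arg_min_linorder P2_feasible_iff)
  define k where "k = t + z *\<^sub>R c - M *v x"
  define G where "G = S \<inter> {x. (transpose M *v w) \<bullet> x = b \<bullet> u}"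
  define E where "E = K \<inter> {k. w \<bullet> k = 0}"
  \<comment> \<open>Complementary slackness: the summands are at least \<open>b \<bullet> u\<close>
    and 0, and they add up to \<open>b \<bullet> u\<close>.\<close>
  have on: "w \<bullet> (M *v x) = b \<bullet> u" "w \<bullet> k = 0"
  proof -
    have "w \<bullet> (M *v x) + w \<bullet> k = w \<bullet> t + z"
      by (simp add: k_def inner_diff_right inner_add_right w(1))
    also have "\<dots> = b \<bullet> u"
      using optimal_values_eq[OF assms(1) P2 D2] by (simp add: inner_commute)
    finally have "w \<bullet> (M *v x) + w \<bullet> k = b \<bullet> u" .
    moreover have "0 \<le> w \<bullet> k"
      using w(2) P2f(2) by (simp add: dual_cone_def k_def)
    ultimately show "w \<bullet> (M *v x) = b \<bullet> u" "w \<bullet> k = 0"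
      using D2_feasible_valid[OF D2f P2f(1)] by linarith+
  qed
  have "G face_of S"
    unfolding G_def using D2_feasible_valid[OF D2f] polyhedron_imp_convex[OF polyhedron_feasible]
    by (intro face_of_Int_supporting_hyperplane_ge)
      (auto simp: inner_transpose_mult simp del: transpose_matrix_vector)
  moreover have "E face_of K"
    unfolding E_def using w(2) polyhedron_K
    by (intro face_of_Int_supporting_hyperplane_ge) (auto simp: polyhedron_imp_convex dual_cone_def)
  moreover have "x \<in> G"
    using on(1) P2f(1) by (simp add: G_def inner_transpose_mult del: transpose_matrix_vector)
  moreover have "k \<in> E"
    using on(2) P2f(2) by (simp add: E_def k_def)
  moreover have "M *v x + k \<in> interior Q"
    using outer_add_interior[OF assms(1,2,5)] by (simp add: k_def)
  ultimately have "(G, E) \<in> live_faces Q"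
    by (auto simp: live_faces_def)
  moreover have "(G, E) \<notin> live_faces (Q \<inter> ?H)"
  proof
    assume "(G, E) \<in> live_faces (Q \<inter> ?H)"
    then obtain x' k' where x': "x' \<in> G" "k' \<in> E" "M *v x' + k' \<in> interior ?H"
      by (auto simp: live_faces_def)
    have "w \<noteq> 0"
      using w(1) by auto
    then have "b \<bullet> u < w \<bullet> (M *v x' + k')"
      using x'(3) by (simp add: interior_halfspace_ge)
    moreover have "w \<bullet> (M *v x') = b \<bullet> u" "w \<bullet> k' = 0"
      using x'(1,2) by (simp_all add: G_def E_def inner_transpose_mult del: transpose_matrix_vector)
    ultimately show False
      by (simp add: inner_add_right)
  qed
  ultimately show "live_faces (Q \<inter> ?H) \<noteq> live_faces Q"
    by blast
qed

section \<open>Invariant and rank of the primal algorithm\<close>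

abbreviation "minimal_vertex Q \<equiv> is_arg_min F (\<lambda>y. y \<in> vertices Q)"

abbreviation "solution \<equiv> is_arg_min (\<lambda>x. F (M *v x)) (\<lambda>x. x \<in> S)"

fun primal_inv :: "('n, 'm, 'p) primal_state \<Rightarrow> bool" where
  "primal_inv (PEnumerate Q) \<longleftrightarrow> outer Q"
| "primal_inv (PChoose Q X) \<longleftrightarrow> outer Q \<and> X = vertices Q"
| "primal_inv (PSolveP Q t) \<longleftrightarrow> outer Q \<and> minimal_vertex Q t"
| "primal_inv (PSolveD Q t x z) \<longleftrightarrow>
    outer Q \<and> minimal_vertex Q t \<and> P2_optimal A b M Z c t (x, z)"
| "primal_inv (PTest Q x z u w) \<longleftrightarrow> (\<exists>t. outer Q \<and> minimal_vertex Q t \<and>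
    P2_optimal A b M Z c t (x, z) \<and> D2_optimal A b M V c t (u, w))"
| "primal_inv (PReturn x) \<longleftrightarrow> solution x"

text \<open>The offsets count down one round. The factor 6 exceeds each of them, so the loss of one
  live pair pays for the return from \<open>PTest\<close> to \<open>PEnumerate\<close>.\<close>

fun primal_rank :: "('n, 'm, 'p) primal_state \<Rightarrow> nat" where
  "primal_rank (PEnumerate Q) = 6 * card (live_faces Q) + 5"
| "primal_rank (PChoose Q X) = 6 * card (live_faces Q) + 4"
| "primal_rank (PSolveP Q t) = 6 * card (live_faces Q) + 3"
| "primal_rank (PSolveD Q t x z) = 6 * card (live_faces Q) + 2"
| "primal_rank (PTest Q x z u w) = 6 * card (live_faces Q) + 1"
| "primal_rank (PReturn x) = 0"

theorem primal_correct_and_finite: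
  assumes "outer Q"
  shows "correct_and_finite (primal_step A b M F V Z c) (PEnumerate Q) PReturn solution"
proof (rule correct_and_finiteI[where Inv = primal_inv and r = "Wellfounded.measure primal_rank"])
  show "primal_inv s' \<and> (s', s) \<in> Wellfounded.measure primal_rank"
    if inv: "primal_inv s" and run: "primal_step A b M F V Z c s s'" for s s'
    using run inv
  proof cases
    case (cut z Q x u w)
    then obtain t where t: "outer Q" "minimal_vertex Q t" "P2_optimal A b M Z c t (x, z)"
      "D2_optimal A b M V c t (u, w)"
      using inv by auto
    then have "t \<in> Q"
      using vertices_subset by (auto simp: is_arg_min_linorder)
    with cut t show ?thesis
      using D2_cut[OF t(1,4)] primal_cut_decreases[OF t(1) _ t(3,4)] by simp
  next
    case (stop z Q x u w)
    then obtain t where t: "outer Q" "minimal_vertex Q t" "P2_optimal A b M Z c t (x, z)"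
      using inv by auto
    then have "x \<in> S" "t + z *\<^sub>R c - M *v x \<in> K"
      by (auto simp: P2_optimal_def is_arg_min_linorder P2_feasible_iff)
    \<comment> \<open>As \<open>z \<le> 0\<close>, this cone vector can be added to the slack, which
      shows that \<open>t\<close> itself dominates \<open>M *v x\<close>.\<close>
    moreover have "(- z) *\<^sub>R c \<in> K"
      using stop c_in_K by (intro K_scale) auto
    ultimately have "t - M *v x \<in> K"
      using K_add by fastforce
    then have "t = M *v x"
      using t(1,2) \<open>x \<in> S\<close> by (intro vertex_above_image) (auto simp: is_arg_min_linorder)
    with t(1,2) \<open>x \<in> S\<close> stop show ?thesis
      using optimal_at_vertex by simp
  qed auto
  show "(\<exists>x. s = PReturn x) \<or> (\<exists>s'. primal_step A b M F V Z c s s')" if inv: "primal_inv s" for s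
  proof (cases s)
    case (PEnumerate Q)
    then show ?thesis
      using inv outer_finite_vertices primal_step.enumerate by fastforce
  next
    case (PChoose Q X)
    then show ?thesis
      using inv ex_is_arg_min_finite[OF outer_finite_vertices outer_vertices_nonempty, of Q F]
        primal_step.choose by fastforce
  next
    case (PSolveP Q t)
    then obtain x z where "P2_optimal A b M Z c t (x, z)"
      using inv ex_P2_optimal by (metis primal_inv.simps(3) surj_pair)
    then show ?thesis
      using PSolveP primal_step.solve_P2 by blast
  next
    case (PSolveD Q t x z)
    then obtain u w where "D2_optimal A b M V c t (u, w)"
      using inv ex_D2_optimal by (metis primal_inv.simps(4) surj_pair)
    then show ?thesis
      using PSolveD primal_step.solve_D2 by blast
  next
    case (PTest Q x z u w)
    moreover have "\<exists>s'. primal_step A b M F V Z c (PTest Q x z u w) s'"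
      by (cases "0 < z") (rule exI, erule primal_step.cut primal_step.stop)+
    ultimately show ?thesis
      by simp
  qed auto
qed (use assms in auto)

end

section \<open>The dual algorithm\<close>

text \<open>The map taking \<open>ys\<close> to \<open>omega l c ys \<bullet> v\<close> is affine;
  this is its gradient. Entry \<open>l\<close> is 0 because \<open>omega\<close> ignores
  \<open>ys $ l\<close>.\<close>

definition omega_grad :: "'p::finite \<Rightarrow> real ^ 'p \<Rightarrow> real ^ 'p \<Rightarrow> real ^ 'p" where
  "omega_grad l c v = (\<chi> i. if i = l then 0 else v $ i - v $ l * c $ i)"

lemma sum_split_at:
  fixes l :: "'p::finite" and h :: "'p \<Rightarrow> 'a::comm_monoid_add"
  shows "(\<Sum>i\<in>UNIV. h i) = h l + (\<Sum>i\<in>UNIV - {l}. h i)"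
  by (simp add: sum.remove)

lemma omega_inner: "omega l c ys \<bullet> v = v $ l + omega_grad l c v \<bullet> ys"
proof -
  have "omega l c ys \<bullet> v =
      (1 - (\<Sum>i\<in>UNIV - {l}. c $ i * ys $ i)) * v $ l + (\<Sum>i\<in>UNIV - {l}. ys $ i * v $ i)"
    unfolding inner_vec_def sum_split_at[of _ l] by (simp add: omega_def)
  moreover have "omega_grad l c v \<bullet> ys = (\<Sum>i\<in>UNIV - {l}. (v $ i - v $ l * c $ i) * ys $ i)"
    unfolding inner_vec_def sum_split_at[of _ l] by (simp add: omega_grad_def)
  ultimately show ?thesis
    by (simp add: algebra_simps sum_subtractf sum_distrib_left)
qed

lemma omega_inner_ray:
  "omega l c (ys + s *\<^sub>R d) \<bullet> v = omega l c ys \<bullet> v + s * (omega_grad l c v \<bullet> d)"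
  by (simp add: omega_inner inner_add_right)

lemma phi_eq: "phi l c y ys = omega l c ys \<bullet> y - ys $ l"
  unfolding phi_def inner_vec_def sum_split_at[of _ l] by (simp add: omega_def mult.commute)

locale dual_vector_program = vector_program A b M F V Z c K
  for A :: "real ^ 'n ^ 'm" and b :: "real ^ 'm" and M :: "real ^ 'n ^ 'p"
    and F :: "real ^ 'p \<Rightarrow> ereal" and V :: "real ^ 'v ^ 'p" and Z :: "real ^ 'z ^ 'p"
    and c :: "real ^ 'p" and K :: "(real ^ 'p) set" +
  fixes l :: 'p
  assumes c_last: "c $ l = 1"
begin

text \<open>With \<open>c $ l = 1\<close> the normalisation can be solved for entry
  \<open>l\<close>, so \<open>omega\<close> parametrises the normalised weights by the other
  entries.\<close>

lemma omega_inner_c: "omega l c ys \<bullet> c = 1"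
proof -
  have "omega_grad l c c = 0"
    by (simp add: omega_grad_def vec_eq_iff c_last)
  then show ?thesis
    by (simp add: omega_inner c_last)
qed

text \<open>A dual point stores a weight and a height in one vector: the normalisation determines
  entry \<open>l\<close> of the weight, which frees that slot.\<close>

definition with_height :: "real ^ 'p \<Rightarrow> real \<Rightarrow> real ^ 'p" where
  "with_height w h = (\<chi> i. if i = l then h else w $ i)"

lemma with_height_last: "with_height w h $ l = h"
  by (simp add: with_height_def)

lemma omega_with_height:
  assumes "w \<bullet> c = 1"
  shows "omega l c (with_height w h) = w"
proof -
  have "(\<Sum>i\<in>UNIV - {l}. c $ i * with_height w h $ i) = (\<Sum>i\<in>UNIV - {l}. w $ i * c $ i)"
    by (intro sum.cong) (auto simp: with_height_def)
  moreover have "w $ l + (\<Sum>i\<in>UNIV - {l}. w $ i * c $ i) = 1"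
    using assms unfolding inner_vec_def sum_split_at[of _ l] by (simp add: c_last)
  ultimately show ?thesis
    by (auto simp: vec_eq_iff omega_def with_height_def)
qed

lemma omega_eq_self:
  assumes "w \<bullet> c = 1"
  shows "omega l c w = w"
proof -
  have "with_height w (w $ l) = w"
    by (simp add: vec_eq_iff with_height_def)
  then show ?thesis
    using omega_with_height[OF assms, of "w $ l"] by simp
qed

text \<open>The set approximated from outside consists of the weights in \<open>dual_cone\<close>
  paired with lower bounds of that weight on the image of \<open>S\<close>.\<close>

definition dual_outer :: "(real ^ 'p) set \<Rightarrow> bool" where
  "dual_outer Q \<longleftrightarrow> polyhedron Q \<and> (\<forall>ys\<in>Q. omega l c ys \<in> dual_cone) \<and>
    (\<forall>ys. omega l c ys \<in> dual_cone \<and> (\<forall>x\<in>S. ys $ l \<le> omega l c ys \<bullet> (M *v x)) \<longrightarrow> ys \<in> Q)"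

text \<open>The initial dual set leaves \<open>ys $ l\<close> free, so it contains vertical lines
  and has no vertices. A single cut bounds the height above every weight.\<close>

definition capped :: "(real ^ 'p) set \<Rightarrow> bool" where
  "capped Q \<longleftrightarrow> (\<exists>y. \<forall>ys\<in>Q. 0 \<le> phi l c y ys)"

lemma dual_outer_init: "dual_outer {ys. \<forall>j. 0 \<le> column j V \<bullet> omega l c ys}"
proof -
  have "{ys. \<forall>j. 0 \<le> column j V \<bullet> omega l c ys} =
      {ys. \<forall>j. - (column j V $ l) \<le> omega_grad l c (column j V) \<bullet> ys}"
    by (auto simp: inner_commute[of "column _ V"] omega_inner) smt+
  then have "polyhedron {ys. \<forall>j. 0 \<le> column j V \<bullet> omega l c ys}"
    by (simp only: polyhedron_Collect_all_ge)
  then show ?thesis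
    by (auto simp: dual_outer_def dual_cone_iff)
qed

lemma dual_outer_cut:
  assumes "dual_outer Q" "x \<in> S"
  shows "dual_outer (Q \<inter> {ys. 0 \<le> phi l c (M *v x) ys})"
proof -
  have "{ys. 0 \<le> phi l c (M *v x) ys} =
      {ys. - ((M *v x) $ l) \<le> (omega_grad l c (M *v x) - axis l 1) \<bullet> ys}"
    by (auto simp: phi_eq omega_inner inner_diff_left inner_axis')
  then have "polyhedron {ys. 0 \<le> phi l c (M *v x) ys}"
    by (simp only: polyhedron_halfspace_ge)
  with assms show ?thesis
    by (auto simp: dual_outer_def phi_eq)
qed

lemma capped_cut: "capped (Q \<inter> {ys. 0 \<le> phi l c y ys})"
  by (auto simp: capped_def)

lemma dual_outer_nonempty:
  assumes "dual_outer Q" "outer R"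
  shows "Q \<noteq> {}"
proof -
  obtain \<gamma> where "\<And>y. y \<in> R \<Longrightarrow> \<gamma> \<le> base_point \<bullet> y"
    using outer_bounded_below[OF assms(2) base_point(1)] by blast
  then have "with_height base_point \<gamma> \<in> Q"
    using assms base_point outer_image[OF assms(2)]
    by (auto simp: dual_outer_def omega_with_height with_height_last)
  then show ?thesis
    by blast
qed

text \<open>Along a recession direction the weight changes by multiples of some \<open>w\<close> in
  \<open>dual_cone\<close> with \<open>w \<bullet> c = 0\<close>, and such a \<open>w\<close>
  vanishes. Only vertical directions remain, and the cap forbids going up.\<close>

lemma dual_recession:
  assumes "dual_outer Q" "capped Q" "Q \<noteq> {}" and d: "d \<in> recession_cone Q"
  shows "omega_grad l c v \<bullet> d = 0" "d $ l \<le> 0" "i \<noteq> l \<Longrightarrow> d $ i = 0"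
proof -
  obtain y0 where "y0 \<in> Q"
    using assms(3) by blast
  then have ray: "y0 + s *\<^sub>R d \<in> Q" if "0 \<le> s" for s
    using d that by (auto simp: recession_cone_def)
  define w where "w = omega l c d - omega l c 0"
  have w_inner: "w \<bullet> k = omega_grad l c k \<bullet> d" for k
    by (simp add: w_def inner_diff_left omega_inner)
  have "w \<in> dual_cone"
    unfolding dual_cone_def
  proof (intro CollectI ballI)
    fix k assume "k \<in> K"
    show "0 \<le> w \<bullet> k"
    proof (rule nonneg_slope)
      fix s :: real assume "0 \<le> s"
      then have "0 \<le> omega l c (y0 + s *\<^sub>R d) \<bullet> k"
        using ray assms(1) \<open>k \<in> K\<close> by (auto simp: dual_outer_def dual_cone_def)
      then show "0 \<le> omega l c y0 \<bullet> k + s * (w \<bullet> k)"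
        by (simp add: omega_inner_ray w_inner)
    qed
  qed
  moreover have "w \<bullet> c = 0"
    by (simp add: w_def inner_diff_left omega_inner_c)
  ultimately have "w = 0"
    using dual_cone_pos by fastforce
  then show grad: "omega_grad l c v \<bullet> d = 0" for v
    using w_inner[of v] by simp
  show "d $ i = 0" if "i \<noteq> l"
  proof -
    have "w $ i = d $ i"
      using that by (simp add: w_def omega_def)
    with \<open>w = 0\<close> show ?thesis
      by simp
  qed
  obtain y where y: "\<And>ys. ys \<in> Q \<Longrightarrow> 0 \<le> phi l c y ys"
    using assms(2) by (auto simp: capped_def)
  have "0 \<le> - (d $ l)"
  proof (rule nonneg_slope)
    fix s :: real assume "0 \<le> s"
    then show "0 \<le> phi l c y y0 + s * - (d $ l)"
      using y[OF ray] by (simp add: phi_eq omega_inner_ray grad algebra_simps)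
  qed
  then show "d $ l \<le> 0"
    by simp
qed

lemma dual_outer_finite_vertices: "dual_outer Q \<Longrightarrow> finite (vertices Q)"
  by (simp add: dual_outer_def vertices_def finite_polyhedron_extreme_points)

lemma dual_decomposition:
  assumes "dual_outer Q" "capped Q" "ys \<in> Q"
  obtains v d where "v \<in> convex hull (vertices Q)" "ys = v + d"
    "\<And>y. omega_grad l c y \<bullet> d = 0" "d $ l \<le> 0"
proof -
  have ne: "Q \<noteq> {}"
    using assms(3) by blast
  note rec = dual_recession[OF assms(1,2) ne]
  have "pointed (recession_cone Q)"
    unfolding pointed_def
  proof (intro equalityI subsetI)
    fix d assume "d \<in> recession_cone Q \<inter> uminus ` recession_cone Q"
    then have d: "d \<in> recession_cone Q" "- d \<in> recession_cone Q"
      by auto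
    have "d $ i = 0" for i
      using rec(2)[OF d(1)] rec(2)[OF d(2)] rec(3)[OF d(1), of i] by (cases "i = l") auto
    then show "d \<in> {0}"
      by (simp add: vec_eq_iff)
  qed (auto simp: recession_cone_def image_iff)
  moreover have "polyhedron Q"
    using assms(1) by (simp add: dual_outer_def)
  ultimately obtain v d where "v \<in> convex hull (vertices Q)" "d \<in> recession_cone Q" "ys = v + d"
    using polyhedron_decomposition assms(3) by metis
  with rec that show thesis
    by blast
qed

lemma dual_vertices_nonempty:
  assumes "dual_outer Q" "capped Q" "outer R"
  shows "vertices Q \<noteq> {}"
proof -
  obtain ys where "ys \<in> Q"
    using dual_outer_nonempty[OF assms(1,3)] by blast
  from dual_decomposition[OF assms(1,2) this]
  obtain v where "v \<in> convex hull (vertices Q)" .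
  then show ?thesis
    by auto
qed

text \<open>A certificate \<open>(u, w)\<close> from \<open>D2\<close> becomes the dual point with
  weight \<open>w\<close> and height \<open>b \<bullet> u\<close>. Since \<open>phi l c t\<close> is
  affine and does not decrease downwards, its sign at the vertices passes to this point; that says
  \<open>b \<bullet> u \<le> w \<bullet> t\<close>, hence \<open>z \<le> 0\<close>.\<close>

lemma dual_test_sound:
  assumes "outer R" "dual_outer Q" "capped Q"
    and nonneg: "\<And>ys. ys \<in> vertices Q \<Longrightarrow> 0 \<le> phi l c t ys"
  obtains x where "x \<in> S" "t - M *v x \<in> K"
proof -
  obtain x z u w where P2: "P2_optimal A b M Z c t (x, z)" and D2: "D2_feasible A M V c (u, w)"
    and gap: "z \<le> b \<bullet> u - t \<bullet> w"
    using strong_duality[OF assms(1)] .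
  have w: "w \<bullet> c = 1" "w \<in> dual_cone"
    using D2 by (auto simp: D2_feasible_iff)
  let ?ys = "with_height w (b \<bullet> u)"
  have "?ys \<in> Q"
    using assms(2) w D2_feasible_valid[OF D2]
    by (simp add: dual_outer_def omega_with_height with_height_last)
  from dual_decomposition[OF assms(2,3) this]
  obtain v d where v: "v \<in> convex hull (vertices Q)" "?ys = v + d"
    and d: "\<And>y. omega_grad l c y \<bullet> d = 0" "d $ l \<le> 0"
    by blast
  have "vertices Q \<subseteq> {ys. - (t $ l) \<le> (omega_grad l c t - axis l 1) \<bullet> ys}"
    using nonneg by (force simp: phi_eq omega_inner inner_diff_left inner_axis')
  then have "convex hull (vertices Q) \<subseteq> {ys. - (t $ l) \<le> (omega_grad l c t - axis l 1) \<bullet> ys}"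
    by (intro hull_minimal convex_halfspace_ge)
  then have "0 \<le> phi l c t v"
    using v(1) by (force simp: phi_eq omega_inner inner_diff_left inner_axis')
  then have "0 \<le> phi l c t ?ys"
    using d by (simp add: v(2) phi_eq omega_inner inner_add_right)
  then have "0 \<le> w \<bullet> t - b \<bullet> u"
    by (simp add: phi_eq omega_with_height[OF w(1)] with_height_last)
  then have "(- z) *\<^sub>R c \<in> K"
    using gap c_in_K by (intro K_scale) (auto simp: inner_commute)
  moreover have "x \<in> S" "t + z *\<^sub>R c - M *v x \<in> K"
    using P2 by (auto simp: P2_optimal_def is_arg_min_linorder P2_feasible_iff)
  ultimately have "t - M *v x \<in> K"
    using K_add by fastforce
  with \<open>x \<in> S\<close> that show thesis
    by blast
qed

lemma ex_P1_optimal: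
  assumes "outer R" "w \<in> dual_cone"
  shows "\<exists>x. P1_optimal A b M w x"
proof -
  have feas: "(\<forall>i\<in>UNIV. b $ i \<le> x \<bullet> A $ i) \<longleftrightarrow> x \<in> S" for x
    by (simp add: feasible_def less_eq_vec_def matrix_vector_mul_component inner_commute)
  obtain x0 where x0: "\<forall>i\<in>UNIV. b $ i \<le> x0 \<bullet> A $ i"
    using feasible_nonempty feas by blast
  obtain \<gamma> where \<gamma>: "\<And>y. y \<in> R \<Longrightarrow> \<gamma> \<le> w \<bullet> y"
    using outer_bounded_below[OF assms] by blast
  have obj: "x \<bullet> (transpose M *v w) = w \<bullet> (M *v x)" for x
    by (rule trans[OF inner_commute inner_transpose_mult[symmetric]])
  have below: "\<gamma> \<le> x \<bullet> (transpose M *v w)" if "\<forall>i\<in>UNIV. b $ i \<le> x \<bullet> A $ i" for x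
    using that \<gamma> outer_image[OF assms(1)] unfolding obj feas by blast
  obtain x where "x \<in> S" "\<And>x'. x' \<in> S \<Longrightarrow> w \<bullet> (M *v x) \<le> w \<bullet> (M *v x')"
    using LP_attains[OF finite x0 below] unfolding obj feas by blast
  then show ?thesis
    by (auto simp: P1_optimal_iff)
qed

text \<open>\<open>G\<close> is live while some point of \<open>Q\<close> whose weight has solution
  set \<open>G\<close> lies too high, so that a cut by a point of \<open>G\<close> would remove
  it.\<close>

definition dual_live_faces :: "(real ^ 'p) set \<Rightarrow> (real ^ 'n) set set" where
  "dual_live_faces Q = {G. G face_of S \<and> (\<exists>ys\<in>Q. G = {x. P1_optimal A b M (omega l c ys) x} \<and>
    (\<forall>x\<in>G. omega l c ys \<bullet> (M *v x) < ys $ l))}"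

lemma finite_dual_live_faces: "finite (dual_live_faces Q)"
  using finite_polyhedron_faces[OF polyhedron_feasible[of A b]]
  by (rule rev_finite_subset) (auto simp: dual_live_faces_def)

lemma P1_optimal_face:
  assumes "P1_optimal A b M w x"
  shows "{x'. P1_optimal A b M w x'} face_of S"
proof -
  have "{x'. P1_optimal A b M w x'} = S \<inter> {x'. (transpose M *v w) \<bullet> x' = w \<bullet> (M *v x)}"
    using assms by (force simp: P1_optimal_iff inner_transpose_mult simp del: transpose_matrix_vector)
  also have "\<dots> face_of S"
    using assms polyhedron_imp_convex[OF polyhedron_feasible]
    by (intro face_of_Int_supporting_hyperplane_ge)
      (auto simp: P1_optimal_iff inner_transpose_mult simp del: transpose_matrix_vector)
  finally show ?thesis .
qed

text \<open>After cutting with \<open>M *v x\<close>, no \<open>y\<^sup>*\<close> whose optimal face contains \<open>x\<close> can be cut off again.\<close>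

lemma dual_cut_decreases:
  assumes "ys \<in> Q" and x: "P1_optimal A b M (omega l c ys) x"
    and above: "omega l c ys \<bullet> (M *v x) < ys $ l"
  shows "card (dual_live_faces (Q \<inter> {ys. 0 \<le> phi l c (M *v x) ys})) < card (dual_live_faces Q)"
proof (rule psubset_card_mono[OF finite_dual_live_faces psubsetI])
  let ?Q = "Q \<inter> {ys. 0 \<le> phi l c (M *v x) ys}"
  let ?G = "{x'. P1_optimal A b M (omega l c ys) x'}"
  show "dual_live_faces ?Q \<subseteq> dual_live_faces Q"
    by (auto simp: dual_live_faces_def)
  have "omega l c ys \<bullet> (M *v x') < ys $ l" if "x' \<in> ?G" for x'
    using that x above by (force simp: P1_optimal_iff)
  then have "?G \<in> dual_live_faces Q"
    using P1_optimal_face[OF x] assms(1) by (auto simp: dual_live_faces_def)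
  moreover have "?G \<notin> dual_live_faces ?Q"
    using x by (fastforce simp: dual_live_faces_def phi_eq)
  ultimately show "dual_live_faces ?Q \<noteq> dual_live_faces Q"
    by blast
qed

section \<open>Invariant and rank of the dual algorithm\<close>

definition valid_pair :: "(real ^ 'p) set \<Rightarrow> (real ^ 'p) set \<Rightarrow> bool" where
  "valid_pair Q Qs \<longleftrightarrow> outer Q \<and> dual_outer Qs"

text \<open>A point enters \<open>T\<close> once its height is confirmed as a lower bound, and the
  primal cut that follows enforces its inequality on \<open>Q\<close>. This keeps the selection
  outside \<open>T\<close> from running empty.\<close>

definition processed :: "(real ^ 'p) set \<Rightarrow> (real ^ 'p) set \<Rightarrow> bool" where
  "processed Q T \<longleftrightarrow> (\<forall>ys\<in>T. \<forall>y\<in>Q. 0 \<le> phi l c y ys)"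

definition enumerated :: "(real ^ 'p) set \<Rightarrow> (real ^ 'p) set option \<Rightarrow> bool" where
  "enumerated Qs X \<longleftrightarrow> X = Some (vertices Qs) \<and> capped Qs"

text \<open>The disjunction separates the first round, with infinite height and no dual vertices
  computed, from all later ones.\<close>

fun solve_inv :: "(real ^ 'p) set \<Rightarrow> (real ^ 'p) set \<Rightarrow> (real ^ 'p) set option \<Rightarrow> (real ^ 'p) set
    \<Rightarrow> real ^ 'p \<Rightarrow> ereal \<Rightarrow> bool" where
  "solve_inv Q Qs X T ts tp \<longleftrightarrow> valid_pair Q Qs \<and> processed Q T \<and> omega l c ts \<in> dual_cone \<and>
    (X = None \<and> tp = \<infinity> \<or> enumerated Qs X \<and> tp = ereal (ts $ l) \<and> ts \<in> vertices Qs - T)"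

fun dual_inv :: "('n, 'p) dual_state \<Rightarrow> bool" where
  "dual_inv (DSolve Q Qs X T ts tp) \<longleftrightarrow> solve_inv Q Qs X T ts tp"
| "dual_inv (DUpdate Q Qs X T ts tp x) \<longleftrightarrow>
    solve_inv Q Qs X T ts tp \<and> P1_optimal A b M (omega l c ts) x"
| "dual_inv (DEnumDual Q Qs T ts x) \<longleftrightarrow> valid_pair Q Qs \<and> processed Q T \<and> capped Qs \<and>
    omega l c ts \<in> dual_cone \<and> P1_optimal A b M (omega l c ts) x"
| "dual_inv (DCutPrimal Q Qs X T ts x) \<longleftrightarrow> valid_pair Q Qs \<and> enumerated Qs X \<and>
    processed (Q \<inter> {y. omega l c ts \<bullet> (M *v x) \<le> omega l c ts \<bullet> y}) T \<and>
    omega l c ts \<in> dual_cone \<and> P1_optimal A b M (omega l c ts) x"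
| "dual_inv (DEnumPrimal Q Qs X T) \<longleftrightarrow> valid_pair Q Qs \<and> enumerated Qs X \<and> processed Q T"
| "dual_inv (DChoose Q Y Qs X T) \<longleftrightarrow>
    valid_pair Q Qs \<and> enumerated Qs X \<and> processed Q T \<and> Y = vertices Q"
| "dual_inv (DTest Q Qs X T t) \<longleftrightarrow>
    valid_pair Q Qs \<and> enumerated Qs X \<and> processed Q T \<and> minimal_vertex Q t"
| "dual_inv (DSelect Q Qs X T t) \<longleftrightarrow> valid_pair Q Qs \<and> enumerated Qs (Some X) \<and> processed Q T \<and>
    minimal_vertex Q t \<and> (\<exists>ys\<in>X. phi l c t ys < 0)"
| "dual_inv (DRecover t) \<longleftrightarrow> (\<exists>Q. outer Q \<and> minimal_vertex Q t) \<and> (\<exists>x\<in>S. t = M *v x)"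
| "dual_inv (DReturn x) \<longleftrightarrow> solution x"

text \<open>The first component counts the one-time phases (before the first dual enumeration, main
  loop, recovery); within the main loop either a dual face dies, or a vertex moves to \<open>T\<close>.\<close>

fun dual_rank :: "('n, 'p) dual_state \<Rightarrow> nat \<times> nat \<times> nat \<times> nat" where
  "dual_rank (DSolve Q Qs X T ts tp) =
    (if X = None then 2 else 1, card (dual_live_faces Qs), card (vertices Qs - T), 3)"
| "dual_rank (DUpdate Q Qs X T ts tp x) =
    (if X = None then 2 else 1, card (dual_live_faces Qs), card (vertices Qs - T), 2)"
| "dual_rank (DEnumDual Q Qs T ts x) = (1, card (dual_live_faces Qs), card (vertices Qs - T), 9)"
| "dual_rank (DCutPrimal Q Qs X T ts x) = (1, card (dual_live_faces Qs), card (vertices Qs - T), 8)"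
| "dual_rank (DEnumPrimal Q Qs X T) = (1, card (dual_live_faces Qs), card (vertices Qs - T), 7)"
| "dual_rank (DChoose Q Y Qs X T) = (1, card (dual_live_faces Qs), card (vertices Qs - T), 6)"
| "dual_rank (DTest Q Qs X T t) = (1, card (dual_live_faces Qs), card (vertices Qs - T), 5)"
| "dual_rank (DSelect Q Qs X T t) = (1, card (dual_live_faces Qs), card (vertices Qs - T), 4)"
| "dual_rank (DRecover t) = (0, 0, 0, 1)"
| "dual_rank (DReturn x) = (0, 0, 0, 0)"

text \<open>The last component runs down from \<open>DEnumDual\<close> to \<open>DUpdate\<close>. It
  rises again only when an earlier component drops: by the first enumeration, a dying face, or a
  vertex joining \<open>T\<close>.\<close>

abbreviation "rank_order \<equiv> less_than <*lex*> less_than <*lex*> less_than <*lex*> less_than"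

lemma dual_step_inv:
  assumes inv: "dual_inv s" and run: "dual_step l A b M F c s s'"
  shows "dual_inv s' \<and> (dual_rank s', dual_rank s) \<in> rank_order"
  using run inv
proof cases
  case (solve_P1 ts x Q Qs X T tp)
  then show ?thesis
    using inv by auto
next
  case (cut_dual tp ts x Q Qs X T)
  have P1: "P1_optimal A b M (omega l c ts) x" and so: "solve_inv Q Qs X T ts tp"
    using inv cut_dual by auto
  let ?Qs = "Qs \<inter> {ys. 0 \<le> phi l c (M *v x) ys}"
  have "x \<in> S"
    using P1 by (simp add: P1_optimal_iff)
  then have "valid_pair Q ?Qs"
    using so dual_outer_cut by (auto simp: valid_pair_def)
  then have "dual_inv s'"
    using P1 so capped_cut cut_dual by simp
  moreover have "card (dual_live_faces ?Qs) < card (dual_live_faces Qs)" if "X \<noteq> None"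
  proof (rule dual_cut_decreases[OF _ P1])
    show "ts \<in> Qs"
      using so that vertices_subset by auto
    show "omega l c ts \<bullet> (M *v x) < ts $ l"
      using so that cut_dual(3) by auto
  qed
  ultimately show ?thesis
    using cut_dual by auto
next
  case (enumerate_dual Qs Q T ts x)
  then show ?thesis
    using inv by (auto simp: enumerated_def processed_def)
next
  case (keep_dual tp ts x Q Qs X T)
  have P1: "P1_optimal A b M (omega l c ts) x" and so: "solve_inv Q Qs X T ts tp"
    using inv keep_dual by auto
  \<comment> \<open>An infinite height always leads to a cut, so this cannot be the first
    round.\<close>
  have "tp \<noteq> \<infinity>"
    using keep_dual(3) by auto
  then have X: "enumerated Qs X" "tp = ereal (ts $ l)" "ts \<in> vertices Qs - T"
    using so by auto
  then have "ts $ l \<le> omega l c ts \<bullet> (M *v x)"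
    using keep_dual(3) by simp
  \<comment> \<open>On the cut primal set the weight is at least its value at \<open>M *v x\<close>,
    hence at least \<open>ts $ l\<close>, as membership in \<open>T\<close> requires.\<close>
  then have "dual_inv s'"
    using so P1 X(1) keep_dual by (auto simp: processed_def phi_eq)
  moreover have "finite (vertices Qs)"
    using so dual_outer_finite_vertices by (auto simp: valid_pair_def)
  then have "card (vertices Qs - (T \<union> {ts})) < card (vertices Qs - T)"
    using X(3) by (intro psubset_card_mono) auto
  ultimately show ?thesis
    using keep_dual X(1) by (auto simp: enumerated_def)
next
  case (cut_primal Q Qs X T ts x)
  then have P1: "P1_optimal A b M (omega l c ts) x"
    using inv by simp
  then have "outer (Q \<inter> {y. omega l c ts \<bullet> (M *v x) \<le> omega l c ts \<bullet> y})"
    using inv cut_primal by (intro outer_Int_halfspace) (auto simp: valid_pair_def P1_optimal_iff)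
  then show ?thesis
    using inv cut_primal by (auto simp: valid_pair_def)
next
  case (enumerate_primal Q Qs X T)
  then show ?thesis
    using inv by auto
next
  case (choose Y t Q Qs X T)
  then show ?thesis
    using inv by auto
next
  case (test_continue t X ys Q Qs T)
  then show ?thesis
    using inv by (auto simp: is_arg_min_linorder)
next
  case (test_stop t X ys Q Qs T)
  have t: "outer Q" "dual_outer Qs" "capped Qs" "X = vertices Qs" "minimal_vertex Q t"
    using inv test_stop by (auto simp: valid_pair_def enumerated_def)
  have "0 \<le> phi l c t ys'" if "ys' \<in> vertices Qs" for ys'
    using test_stop t(4) that by (force simp: is_arg_min_linorder)
  then obtain x where "x \<in> S" "t - M *v x \<in> K"
    using dual_test_sound[OF t(1-3)] by blast
  then have "\<exists>x\<in>S. t = M *v x"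
    using vertex_above_image[OF t(1)] t(5) by (auto simp: is_arg_min_linorder)
  with t show ?thesis
    using test_stop by auto
next
  case (select t X T ts Q Qs)
  then have "ts \<in> Qs" "dual_outer Qs"
    using inv vertices_subset by (auto simp: is_arg_min_linorder enumerated_def valid_pair_def)
  then have "omega l c ts \<in> dual_cone"
    by (simp add: dual_outer_def)
  then show ?thesis
    using inv select by (auto simp: is_arg_min_linorder enumerated_def)
next
  case (recover x t)
  then show ?thesis
    using inv optimal_at_vertex by auto
qed

lemma dual_progress:
  assumes inv: "dual_inv s"
  shows "(\<exists>x. s = DReturn x) \<or> (\<exists>s'. dual_step l A b M F c s s')"
proof (cases s)
  case (DSolve Q Qs X T ts tp)
  then obtain x where "P1_optimal A b M (omega l c ts) x"
    using inv ex_P1_optimal[of Q "omega l c ts"] by (auto simp: valid_pair_def)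
  then show ?thesis
    using DSolve dual_step.solve_P1 by blast
next
  case (DUpdate Q Qs X T ts tp x)
  moreover have "\<exists>s'. dual_step l A b M F c (DUpdate Q Qs X T ts tp x) s'"
    by (cases "0 < tp - ereal (omega l c ts \<bullet> (M *v x))")
      (rule exI, erule dual_step.cut_dual dual_step.keep_dual)+
  ultimately show ?thesis
    by simp
next
  case (DEnumDual Q Qs T ts x)
  then have "finite (vertices Qs)"
    using inv dual_outer_finite_vertices by (simp add: valid_pair_def)
  then show ?thesis
    using DEnumDual dual_step.enumerate_dual by blast
next
  case (DCutPrimal Q Qs X T ts x)
  then show ?thesis
    using dual_step.cut_primal by blast
next
  case (DEnumPrimal Q Qs X T)
  then have "finite (vertices Q)"
    using inv outer_finite_vertices by (simp add: valid_pair_def)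
  then show ?thesis
    using DEnumPrimal dual_step.enumerate_primal by blast
next
  case (DChoose Q Y Qs X T)
  then obtain t where "is_arg_min F (\<lambda>y. y \<in> Y) t"
    using inv ex_is_arg_min_finite[OF outer_finite_vertices outer_vertices_nonempty, of Q F]
    by (auto simp: valid_pair_def)
  then show ?thesis
    using DChoose dual_step.choose by blast
next
  case (DTest Q Qs X T t)
  then have X: "X = Some (vertices Qs)" "capped Qs" "dual_outer Qs" "outer Q"
    using inv by (auto simp: valid_pair_def enumerated_def)
  obtain ys where ys: "is_arg_min (phi l c t) (\<lambda>ys. ys \<in> vertices Qs) ys"
    using ex_is_arg_min_finite[OF dual_outer_finite_vertices[OF X(3)]
        dual_vertices_nonempty[OF X(3,2,4)]] by blast
  have "\<exists>s'. dual_step l A b M F c (DTest Q Qs (Some (vertices Qs)) T t) s'"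
    by (cases "phi l c t ys < 0")
      (rule exI, erule dual_step.test_continue[OF ys] dual_step.test_stop[OF ys])+
  then show ?thesis
    by (simp add: DTest X(1))
next
  case (DSelect Q Qs X T t)
  then have *: "X = vertices Qs" "dual_outer Qs" "processed Q T" "t \<in> Q"
    using inv vertices_subset by (auto simp: valid_pair_def enumerated_def is_arg_min_linorder)
  obtain ys where "ys \<in> X" "phi l c t ys < 0"
    using inv DSelect by auto
  moreover from this have "ys \<notin> T"
    using *(3,4) by (force simp: processed_def)
  ultimately have "X - T \<noteq> {}"
    by blast
  moreover have "finite (X - T)"
    using dual_outer_finite_vertices * by simp
  ultimately obtain ts where "is_arg_min (phi l c t) (\<lambda>ys. ys \<in> X - T) ts"
    using ex_is_arg_min_finite by blast
  then show ?thesis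
    using DSelect dual_step.select by blast
next
  case (DRecover t)
  then show ?thesis
    using inv dual_step.recover by fastforce
qed auto

theorem dual_correct_and_finite:
  assumes "outer Q"
  shows "correct_and_finite (dual_step l A b M F c) (dual_init l V Z c Q) DReturn solution"
proof (rule correct_and_finiteI[where Inv = dual_inv and r = "inv_image rank_order dual_rank"])
  have "(dual_init l V Z c Q :: ('n, 'p) dual_state) =
      DSolve Q {ys. \<forall>j. 0 \<le> column j V \<bullet> omega l c ys} None {} base_point \<infinity>"
    by (simp add: dual_init_def base_point_def Let_def)
  then show "dual_inv (dual_init l V Z c Q)"
    using assms dual_outer_init base_point
    by (simp add: valid_pair_def processed_def omega_eq_self)
  show "wf (inv_image rank_order dual_rank)"
    by (intro wf_inv_image wf_lex_prod wf_less_than)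
qed (use dual_step_inv dual_progress in auto)

end

section \<open>Reduction of the original problem\<close>

definition unstack :: "real ^ 'q option \<Rightarrow> real ^ 'q" where
  "unstack v = (\<chi> i. v $ Some i)"

text \<open>The last coordinate is chosen to make the image the hyperplane
  \<open>1 \<bullet> v = 0\<close>.\<close>

definition lift :: "real ^ 'q \<Rightarrow> real ^ 'q option" where
  "lift y = stack y (- (1 \<bullet> y))"

lemma inner_one_option:
  fixes v :: "real ^ ('q::finite) option"
  shows "1 \<bullet> v = 1 \<bullet> unstack v + v $ None"
  by (simp add: inner_vec_def unstack_def UNIV_option_conv sum.reindex)

lemma linear_unstack: "linear unstack"
  by (intro linearI) (simp_all add: unstack_def vec_eq_iff)

lemma unstack_lift: "unstack (lift y) = y"
  by (simp add: unstack_def lift_def stack_def vec_eq_iff)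

lemma inner_one_lift: "1 \<bullet> lift y = 0"
  unfolding inner_one_option unstack_lift by (simp add: lift_def stack_def)

lemma lift_zero: "lift 0 = 0"
  by (simp add: lift_def stack_def vec_eq_iff split: option.split)

lemma P_bar_mult: "P_bar P *v x = lift (P *v x)"
proof -
  have "(1 v* P) \<bullet> x = 1 \<bullet> (P *v x)"
    by (rule dot_lmul_matrix)
  then show ?thesis
    by (auto simp: vec_eq_iff P_bar_def lift_def stack_def matrix_vector_mul_component
        split: option.split)
qed

lemma f_bar_eq: "f_bar f v = (if 0 \<le> 1 \<bullet> v then f (unstack v) else - \<infinity>)"
  by (simp add: f_bar_def Let_def inner_one_option unstack_def)

lemma f_bar_P_bar: "f_bar f (P_bar P *v x) = f (P *v x)"
  by (simp add: f_bar_eq P_bar_mult inner_one_lift unstack_lift)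

section \<open>The lifted ordering cone and objective\<close>

lemma R_cone_iff: "v \<in> R_cone Y \<longleftrightarrow> (\<exists>a\<ge>0. \<exists>k\<in>generated_cone Y. v = a + lift k)"
  by (auto simp: R_cone_def generated_cone_def lift_def)

lemma inner_one_nonneg:
  fixes a :: "real ^ 'r"
  assumes "0 \<le> a"
  shows "0 \<le> 1 \<bullet> a" and "1 \<bullet> a = 0 \<Longrightarrow> a = 0"
proof -
  have a: "\<And>i. 0 \<le> a $ i"
    using assms by (simp add: less_eq_vec_def)
  have "1 \<bullet> a = (\<Sum>i\<in>UNIV. a $ i)"
    by (simp add: inner_vec_def)
  then show "0 \<le> 1 \<bullet> a" and "1 \<bullet> a = 0 \<Longrightarrow> a = 0"
    using a by (simp_all add: sum_nonneg sum_nonneg_eq_0_iff vec_eq_iff)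
qed

lemma R_cone_inner_one: "v \<in> R_cone Y \<Longrightarrow> 0 \<le> 1 \<bullet> v"
  by (auto simp: R_cone_iff inner_add_right inner_one_lift inner_one_nonneg)

text \<open>Lifted vectors have coordinate sum 0, so on the hyperplane the nonnegative summand has
  sum 0 and vanishes.\<close>

lemma R_cone_flat:
  assumes "v \<in> R_cone Y" "1 \<bullet> v = 0"
  shows "unstack v \<in> generated_cone Y" "v = lift (unstack v)"
  using assms by (auto simp: R_cone_iff inner_add_right inner_one_lift unstack_lift dest!: inner_one_nonneg(2))

text \<open>Both \<open>v\<close> and \<open>- v\<close> have nonnegative coordinate sum, which
  forces them into the hyperplane, where the original cone decides.\<close>

lemma pointed_R_cone:
  assumes "pointed (generated_cone Y)"
  shows "pointed (R_cone Y)"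
  unfolding pointed_def
proof (intro equalityI subsetI)
  fix v assume "v \<in> R_cone Y \<inter> uminus ` R_cone Y"
  then have v: "v \<in> R_cone Y" "- v \<in> R_cone Y"
    by auto
  then have flat: "1 \<bullet> v = 0" "1 \<bullet> - v = 0"
    using R_cone_inner_one[of v Y] R_cone_inner_one[of "- v" Y] by simp_all
  have "unstack (- v) = - unstack v"
    by (rule linear_neg[OF linear_unstack])
  then have "unstack v \<in> generated_cone Y \<inter> uminus ` generated_cone Y"
    using R_cone_flat(1)[OF v(1) flat(1)] R_cone_flat(1)[OF v(2) flat(2)]
    by (metis IntI image_eqI minus_minus)
  then have "unstack v = 0"
    using assms by (auto simp: pointed_def)
  then show "v \<in> {0}"
    using R_cone_flat(2)[OF v(1) flat(1)] by (simp add: lift_zero)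
next
  have "0 \<in> generated_cone Y"
    unfolding generated_cone_def by (auto intro!: exI[of _ 0])
  then have "0 \<in> R_cone Y"
    unfolding R_cone_iff by (auto intro!: exI[of _ 0] bexI[of _ 0] simp: lift_zero)
  then show "v \<in> R_cone Y \<inter> uminus ` R_cone Y" if "v \<in> {0}" for v
    using that by (auto simp: image_iff intro!: bexI[of _ 0])
qed

text \<open>The value \<open>- \<infinity>\<close> lies below every real level, so a superlevel set
  is a half-space intersected with a linear preimage of a convex set.\<close>

lemma quasi_concave_f_bar:
  assumes "quasi_concave f"
  shows "quasi_concave (f_bar f)"
  unfolding quasi_concave_def
proof
  fix r :: real
  have "{v. ereal r \<le> f_bar f v} = {v. 0 \<le> 1 \<bullet> v} \<inter> unstack -` {y. ereal r \<le> f y}"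
    by (auto simp: f_bar_eq)
  moreover have "convex (unstack -` {y. ereal r \<le> f y})"
    using assms by (intro convex_linear_vimage linear_unstack) (auto simp: quasi_concave_def)
  ultimately show "convex {v. ereal r \<le> f_bar f v}"
    by (simp add: convex_Int convex_halfspace_ge)
qed

text \<open>All points of \<open>P_bar P [S] - R\<close> lie in the half-space \<open>e\<^sup>T y + \<eta> \<le> 0\<close>, and the ones on its
  boundary are lifted points of \<open>P [S] - C\<close>; elsewhere \<open>f_bar f\<close> is \<open>-\<infinity>\<close>.\<close>

lemma cone_monotone_on_f_bar:
  assumes mono: "cone_monotone_on (generated_cone Y)
    {P *v x - k | x k. x \<in> S \<and> k \<in> generated_cone Y} f"
  shows "cone_monotone_on (R_cone Y) {P_bar P *v x - k | x k. x \<in> S \<and> k \<in> R_cone Y} (f_bar f)"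
  unfolding cone_monotone_on_def
proof (intro ballI impI)
  let ?D = "{P_bar P *v x - k | x k. x \<in> S \<and> k \<in> R_cone Y}"
  let ?E = "{P *v x - k | x k. x \<in> S \<and> k \<in> generated_cone Y}"
  have below: "1 \<bullet> v \<le> 0" if "v \<in> ?D" for v
    using that R_cone_inner_one by (auto simp: inner_diff_right P_bar_mult inner_one_lift)
  have flat: "unstack v \<in> ?E" if v: "v \<in> ?D" "1 \<bullet> v = 0" for v
  proof -
    obtain x k where xk: "v = P_bar P *v x - k" "x \<in> S" "k \<in> R_cone Y"
      using v(1) by blast
    then have "1 \<bullet> k = 0"
      using v(2) by (simp add: inner_diff_right P_bar_mult inner_one_lift)
    then have "unstack k \<in> generated_cone Y"
      using R_cone_flat(1) xk(3) by blast
    moreover have "unstack v = P *v x - unstack k"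
      unfolding xk(1) linear_diff[OF linear_unstack] by (simp add: P_bar_mult unstack_lift)
    ultimately show ?thesis
      using xk(2) by blast
  qed
  fix u v assume uv: "u \<in> ?D" "v \<in> ?D" "v - u \<in> R_cone Y"
  show "f_bar f u \<le> f_bar f v"
  proof (cases "0 \<le> 1 \<bullet> u")
    case True
    have "0 \<le> 1 \<bullet> v - 1 \<bullet> u"
      using R_cone_inner_one[OF uv(3)] by (simp add: inner_diff_right)
    then have eq: "1 \<bullet> u = 0" "1 \<bullet> v = 0"
      using True below[OF uv(1)] below[OF uv(2)] by linarith+
    have "unstack (v - u) \<in> generated_cone Y"
      using R_cone_flat(1)[OF uv(3)] eq by (simp add: inner_diff_right)
    then have "f (unstack u) \<le> f (unstack v)"
      using mono flat[OF uv(1) eq(1)] flat[OF uv(2) eq(2)]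
      unfolding cone_monotone_on_def linear_diff[OF linear_unstack] by blast
    then show ?thesis
      by (simp add: f_bar_eq eq)
  qed (simp add: f_bar_eq)
qed

theorem corollary22:
  fixes P :: "real ^ 'n ^ 'q" and A :: "real ^ 'n ^ 'm" and b :: "real ^ 'm"
    and f :: "real ^ 'q \<Rightarrow> ereal" and Y :: "real ^ 'o ^ 'q"
    and V :: "real ^ 'v ^ 'q option" and Z :: "real ^ 'z ^ 'q option"
    and c :: "real ^ 'q option" and Q :: "(real ^ 'q option) set"
  assumes "feasible A b \<noteq> {}"
    and "quasi_concave f"
    and "pointed (generated_cone Y)"
    and "cone_monotone_on (generated_cone Y)
           {P *v x - k | x k. x \<in> feasible A b \<and> k \<in> generated_cone Y} f"
    and "recession_cone ((*v) P ` feasible A b) \<subseteq> generated_cone Y"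
    and "R_cone Y = generated_cone V"
    and "R_cone Y = {y. 0 \<le> transpose Z *v y}"
    and "c \<in> interior (R_cone Y)"
    and "polyhedron Q"
    and "{P_bar P *v x + k | x k. x \<in> feasible A b \<and> k \<in> R_cone Y} \<subseteq> Q"
    and "recession_cone Q = R_cone Y"
  shows "correct_and_finite (primal_step A b (P_bar P) (f_bar f) V Z c)
           (PEnumerate Q) PReturn
           (is_arg_min (\<lambda>x. f (P *v x)) (\<lambda>x. x \<in> feasible A b)) \<and>
         (c $ None = 1 \<longrightarrow>
         correct_and_finite (dual_step None A b (P_bar P) (f_bar f) c)
           (dual_init None V Z c Q) DReturn
           (is_arg_min (\<lambda>x. f (P *v x)) (\<lambda>x. x \<in> feasible A b)))"
proof -
  interpret vector_program A b "P_bar P" "f_bar f" V Z c "R_cone Y"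
    by (intro vector_program.intro assms(1,6-8) quasi_concave_f_bar[OF assms(2)]
        pointed_R_cone[OF assms(3)] cone_monotone_on_f_bar[OF assms(4)])
  have Q: "outer Q"
    using assms(9-11) by (auto simp: outer_def)
  have "correct_and_finite (dual_step None A b (P_bar P) (f_bar f) c)
      (dual_init None V Z c Q) DReturn solution" if "c $ None = 1"
  proof -
    interpret dual_vector_program A b "P_bar P" "f_bar f" V Z c "R_cone Y" None
      by unfold_locales (rule that)
    show ?thesis
      by (rule dual_correct_and_finite[OF Q])
  qed
  \<comment> \<open>On image points the lifted objective equals the original one, so the solutions
    coincide.\<close>
  then show ?thesis
    using primal_correct_and_finite[OF Q] by (simp add: f_bar_P_bar)
qed

end
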